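(* Let $n\ge 1$ and let $M,M'\in\mathbb{R}^{2n\times 2n}$ be two (symmetric) positive definite matrices with Williamson diagonalisations $\tilde D=\operatorname{diag}(D,D)$ and $\tilde D'=\operatorname{diag}(D',D')$, respectively, where the diagonal entries of $D$ and of $D'$ are in non-increasing order. Then for every unitarily invariant norm $\|\cdot\|$ on $2n\times 2n$ matrices, $$\|\tilde D-\tilde D'\|\le \big(\kappa(M)\,\kappa(M')\big)^{1/2}\,\|M-M'\|.$$
   Context: Let $\sigma=\begin{pmatrix}0&\mathbb{1}_n\\-\mathbb{1}_n&0\end{pmatrix}\in\mathbb{R}^{2n\times 2n}$ be the standard symplectic form and $Sp(2n)$ the group of real $2n\times 2n$ symplectic matrices ($S^T\sigma S=\sigma$). Williamson's theorem: for every symmetric positive definite $M\in\mathbb{R}^{2n\times 2n}$ there exist $S\in Sp(2n)$ and a diagonal matrix $D\in\mathbb{R}^{n\times n}$ with $D_{11}\ge D_{22}\ge\dots\ge D_{nn}>0$ such that $S^TMS=\operatorname{diag}(D,D)$. The entries of $D$ are the symplectic eigenvalues of $M$; they are the positive eigenvalues of $i\sigma M$ (so $D$ is uniquely determined by $M$). The matrix $\tilde D=\operatorname{diag}(D,D)$ is called the Williamson diagonalisation of $M$. The condition number is $\kappa(A)=\|A\|_\infty\|A^{-1}\|_\infty$, where $\|\cdot\|_\infty$ is the operator norm (largest singular value). A norm is unitarily invariant if $\|UAV\|=\|A\|$ for all unitary $U,V$. *)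

theory Defs
  imports
    Complex_Main
    "Jordan_Normal_Form.Gauss_Jordan_Elimination"
    "Jordan_Normal_Form.Schur_Decomposition"
begin

definition pos_def_mat :: "nat \<Rightarrow> real mat \<Rightarrow> bool" where
  "pos_def_mat m M \<longleftrightarrow>
     M \<in> carrier_mat m m \<and> transpose_mat M = M \<and>
     (\<forall>v \<in> carrier_vec m. v \<noteq> 0\<^sub>v m \<longrightarrow> v \<bullet> (M *\<^sub>v v) > 0)"

definition symplectic_form :: "nat \<Rightarrow> real mat" where
  "symplectic_form n = four_block_mat (0\<^sub>m n n) (1\<^sub>m n) (- 1\<^sub>m n) (0\<^sub>m n n)"

definition Sp :: "nat \<Rightarrow> real mat set" where
  "Sp n = {S \<in> carrier_mat (2 * n) (2 * n).
             transpose_mat S * symplectic_form n * S = symplectic_form n}"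

text \<open>\<open>williamson_diag n M D\<close>: the \<open>2n \<times> 2n\<close> matrix \<open>diag_block_mat [D, D]\<close> is the Williamson
  diagonalisation of \<open>M\<close>. This is a relation; for symmetric positive definite \<open>M\<close>, existence of
  \<open>D\<close> is Williamson's theorem, and the ordering of the diagonal makes \<open>D\<close> unique.\<close>

definition williamson_diag :: "nat \<Rightarrow> real mat \<Rightarrow> real mat \<Rightarrow> bool" where
  "williamson_diag n M D \<longleftrightarrow>
     D \<in> carrier_mat n n \<and> diagonal_mat D \<and>
     (\<forall>i<n. D $$ (i, i) > 0) \<and>
     (\<forall>i j. i \<le> j \<and> j < n \<longrightarrow> D $$ (j, j) \<le> D $$ (i, i)) \<and>
     (\<exists>S \<in> Sp n. transpose_mat S * M * S = diag_block_mat [D, D])"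

text \<open>The operator norm for the Euclidean norm, i.e. the largest singular value. The supremum is
  over a nonempty bounded set as soon as the matrix has at least one column.\<close>

definition op_norm :: "real mat \<Rightarrow> real" where
  "op_norm A = (SUP v \<in> {v \<in> carrier_vec (dim_col A). sqrt (v \<bullet> v) = 1}.
                  sqrt ((A *\<^sub>v v) \<bullet> (A *\<^sub>v v)))"

text \<open>Meaningful for invertible matrices only: otherwise \<^term>\<open>mat_inverse A\<close> is \<^term>\<open>None\<close>.\<close>

definition cond_number :: "real mat \<Rightarrow> real" where
  "cond_number A = op_norm A * op_norm (the (mat_inverse A))"

definition unitary_mat :: "nat \<Rightarrow> complex mat \<Rightarrow> bool" where
  "unitary_mat m U \<longleftrightarrow>
     U \<in> carrier_mat m m \<and> mat_adjoint U * U = 1\<^sub>m m \<and> U * mat_adjoint U = 1\<^sub>m m"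

text \<open>Norms on the complex vector space of \<open>m \<times> m\<close> matrices; the values of \<open>N\<close> outside
  \<open>carrier_mat m m\<close> are irrelevant.\<close>

definition mat_norm :: "nat \<Rightarrow> (complex mat \<Rightarrow> real) \<Rightarrow> bool" where
  "mat_norm m N \<longleftrightarrow>
     (\<forall>A \<in> carrier_mat m m. N A \<ge> 0) \<and>
     (\<forall>A \<in> carrier_mat m m. N A = 0 \<longleftrightarrow> A = 0\<^sub>m m m) \<and>
     (\<forall>A \<in> carrier_mat m m. \<forall>c. N (c \<cdot>\<^sub>m A) = cmod c * N A) \<and>
     (\<forall>A \<in> carrier_mat m m. \<forall>B \<in> carrier_mat m m. N (A + B) \<le> N A + N B)"

definition unitarily_invariant_norm :: "nat \<Rightarrow> (complex mat \<Rightarrow> real) \<Rightarrow> bool" where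
  "unitarily_invariant_norm m N \<longleftrightarrow>
     mat_norm m N \<and>
     (\<forall>A \<in> carrier_mat m m. \<forall>U V. unitary_mat m U \<and> unitary_mat m V \<longrightarrow> N (U * A * V) = N A)"

end

theory Submission
  imports Defs "Jordan_Normal_Form.Spectral_Radius"
begin

text \<open>Let \<open>S\<^sup>T M S = diag (D, D)\<close> and \<open>S'\<^sup>T M' S' = diag (D', D')\<close> with \<open>S\<close>, \<open>S'\<close> symplectic, let \<open>J\<close> be the
  symplectic form and put \<open>X = S\<inverse> S'\<close>. Up to unitary factors, \<open>S\<^sup>T (M - M') S'\<close> equals \<open>H X - X H'\<close>
  for the Hermitian matrices \<open>H = i J\<^sup>T diag (D, D)\<close> and \<open>H' = i J\<^sup>T diag (D', D')\<close>, whose spectra consist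
  of the symplectic eigenvalues and their negatives. As \<open>\<parallel>S\<parallel>\<^sup>2 \<le> \<kappa>(M)\<close>, the norm of \<open>H X - X H'\<close> is at
  most the right-hand side of the claim. As \<open>X\<close> is symplectic, replacing it by \<open>X\<inverse>\<^sup>*\<close> does not change
  this norm; in a singular value decomposition \<open>X = U \<Gamma> V\<close> this replaces \<open>\<Gamma>\<close> by \<open>\<Gamma>\<inverse>\<close>. Adding both,
  with \<open>\<Gamma> + \<Gamma>\<inverse> \<ge> 2\<close>, bounds the distance of some unitary conjugates of \<open>H\<close> and \<open>H'\<close>, and Lidskii's
  theorem passes from these to their ordered eigenvalues.\<close>

text \<open>\<open>H\<close> enters instead of \<open>diag (D, D)\<close> because a symplectic
  congruence of \<open>M\<close> is a similarity of \<open>J^T M\<close>: from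
  \<open>J^T S^T = S^{-1} J^T\<close> one gets \<open>J^T S^T M S = S^{-1} (J^T M) S\<close>. The
  obstacle is that \<open>X\<close> need not be orthogonal. A lower bound for
  \<open>H X - X H'\<close> by the distance of the spectra would carry the smallest singular value
  of \<open>X\<close> as a factor, and this can be arbitrarily small. The identity
  \<open>X^{-T} = J X J^T\<close> removes it: \<open>J\<close> commutes with \<open>H\<close> and
  \<open>H'\<close>, so conjugating \<open>X\<close> by \<open>J\<close> multiplies
  \<open>H X - X H'\<close> by unitary factors only. The sum of the two expressions has the form
  \<open>A G - G B\<close> with \<open>A\<close>, \<open>B\<close> Hermitian and
  \<open>G = \<Gamma> + \<Gamma>^{-1}\<close>. Twice its Hermitian part is the anticommutator of
  \<open>G\<close> and \<open>A - B\<close>, and there the bound \<open>G \<ge> 2\<close> can be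
  exploited in every unitarily invariant norm. Such a norm offers only the triangle inequality and
  unitary factors, so products are estimated by writing contractions as averages of unitary
  matrices, and the Hermitian part by first showing that the norm is invariant under the
  adjoint.\<close>

declare assoc_mult_mat [simp del]

section \<open>Adjoints and unitary matrices\<close>

lemma mat_adjoint_dim [simp]:
  "dim_row (mat_adjoint A) = dim_col A" "dim_col (mat_adjoint A) = dim_row A"
  by (simp_all add: mat_adjoint_def)

lemma mat_adjoint_carrier [simp]: "mat_adjoint A \<in> carrier_mat n m \<longleftrightarrow> A \<in> carrier_mat m n"
  unfolding carrier_mat_def by auto

lemma mat_adjoint_index [simp]:
  "i < dim_col A \<Longrightarrow> j < dim_row A \<Longrightarrow> mat_adjoint A $$ (i, j) = cnj (A $$ (j, i))"
  by (simp add: mat_adjoint_def mat_of_rows_def)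

lemma mat_adjoint_adjoint [simp]: "mat_adjoint (mat_adjoint A) = (A :: complex mat)"
  by (rule eq_matI) auto

lemma mat_adjoint_one [simp]: "mat_adjoint (1\<^sub>m n) = (1\<^sub>m n :: complex mat)"
  by (rule eq_matI) auto

lemma mat_adjoint_mult:
  assumes "A \<in> carrier_mat m n" "B \<in> carrier_mat n k"
  shows "mat_adjoint (A * B) = mat_adjoint B * mat_adjoint (A :: complex mat)"
  using assms by (intro eq_matI) (auto simp: scalar_prod_def intro!: sum.cong)

lemma mat_adjoint_add:
  assumes "A \<in> carrier_mat m n" "B \<in> carrier_mat m n"
  shows "mat_adjoint (A + B) = mat_adjoint A + mat_adjoint (B :: complex mat)"
  using assms by (intro eq_matI) auto

lemma mat_adjoint_minus:
  assumes "A \<in> carrier_mat m n" "B \<in> carrier_mat m n"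
  shows "mat_adjoint (A - B) = mat_adjoint A - mat_adjoint (B :: complex mat)"
  using assms by (intro eq_matI) auto

lemma mat_adjoint_smult: "mat_adjoint (c \<cdot>\<^sub>m A) = cnj c \<cdot>\<^sub>m mat_adjoint (A :: complex mat)"
  by (intro eq_matI) auto

lemma mat_adjoint_of_real: "mat_adjoint (map_mat complex_of_real A) = map_mat complex_of_real A\<^sup>T"
  by (intro eq_matI) auto

lemma mat_diag_index [simp]: "i < n \<Longrightarrow> j < n \<Longrightarrow> mat_diag n f $$ (i, j) = (if i = j then f i else 0)"
  by (auto simp: mat_diag_def)

lemma mat_diag_dims [simp]: "dim_row (mat_diag n f) = n" "dim_col (mat_diag n f) = n"
  by (auto simp: mat_diag_def)

lemma mat_adjoint_diag [simp]: "mat_adjoint (mat_diag n f) = mat_diag n (\<lambda>i. cnj (f i))"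
  by (rule eq_matI) auto

lemma mat_diag_add: "mat_diag n f + mat_diag n g = mat_diag n (\<lambda>i. f i + g i :: 'a :: monoid_add)"
  by (rule eq_matI) auto

lemma mat_diag_minus: "mat_diag n f - mat_diag n g = mat_diag n (\<lambda>i. f i - g i :: 'a :: group_add)"
  by (rule eq_matI) auto

lemma mat_diag_cong: "(\<And>i. i < n \<Longrightarrow> f i = g i) \<Longrightarrow> mat_diag n f = mat_diag n g"
  by (rule eq_matI) auto

lemma unitary_matD:
  assumes "unitary_mat m U"
  shows "U \<in> carrier_mat m m" "mat_adjoint U * U = 1\<^sub>m m" "U * mat_adjoint U = 1\<^sub>m m"
  using assms by (auto simp: unitary_mat_def)

lemma unitary_matI:
  assumes "U \<in> carrier_mat m m" "mat_adjoint U * U = 1\<^sub>m m"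
  shows "unitary_mat m U"
  using assms mat_mult_left_right_inverse[of "mat_adjoint U" m U] by (auto simp: unitary_mat_def)

lemma unitary_mat_adjoint: "unitary_mat m U \<Longrightarrow> unitary_mat m (mat_adjoint U)"
  by (auto simp: unitary_mat_def)

lemma unitary_mat_one: "unitary_mat m (1\<^sub>m m)"
  by (rule unitary_matI) auto

lemma mult_cancel_left_inverse:
  assumes "A * B = 1\<^sub>m m" "A \<in> carrier_mat m m" "B \<in> carrier_mat m m" "C \<in> carrier_mat m k"
  shows "A * (B * C) = (C :: 'a :: semiring_1 mat)"
  using assms by (metis assoc_mult_mat left_mult_one_mat)

lemma unitary_mat_mult:
  assumes "unitary_mat m U" "unitary_mat m V"
  shows "unitary_mat m (U * V)"
proof (rule unitary_matI)
  note U = unitary_matD[OF assms(1)] and V = unitary_matD[OF assms(2)]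
  show "U * V \<in> carrier_mat m m" using U V by auto
  have "mat_adjoint (U * V) * (U * V) = mat_adjoint V * (mat_adjoint U * (U * V))"
    using U V by (simp add: mat_adjoint_mult[of _ m m _ m] assoc_mult_mat[of _ m m _ m _ m])
  also have "\<dots> = 1\<^sub>m m" using U V by (simp add: mult_cancel_left_inverse[of _ _ m])
  finally show "mat_adjoint (U * V) * (U * V) = 1\<^sub>m m" .
qed

lemma unitary_mat_diag:
  assumes "\<And>i. i < m \<Longrightarrow> cmod (f i) = 1"
  shows "unitary_mat m (mat_diag m f)"
proof (rule unitary_matI)
  have "cnj (f i) * f i = 1" if "i < m" for i
    using assms[OF that] by (simp add: complex_norm_square[symmetric] mult.commute)
  then show "mat_adjoint (mat_diag m f) * mat_diag m f = 1\<^sub>m m"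
    by (auto intro!: eq_matI)
qed auto

text \<open>Column \<open>j\<close> is the unit vector with index \<open>p j\<close>; with this
  orientation, conjugating a diagonal matrix with entries \<open>f\<close> gives the entries
  \<open>f \<circ> p\<close>.\<close>

definition perm_mat :: "nat \<Rightarrow> (nat \<Rightarrow> nat) \<Rightarrow> complex mat" where
  "perm_mat m p = mat m m (\<lambda>(i, j). if i = p j then 1 else 0)"

lemma perm_mat_conj_index:
  assumes "p permutes {..<m}" "i < m" "j < m"
  shows "(mat_adjoint (perm_mat m p) * mat_diag m f * perm_mat m p) $$ (i, j)
    = (if i = j then f (p i) else 0)"
proof -
  have pl: "p i < m" "p j < m" using permutes_in_image[OF assms(1)] assms by auto
  have inj: "p i = p j \<longleftrightarrow> i = j" using permutes_inj[OF assms(1)] by (auto dest: injD)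
  have c: "mat_adjoint (perm_mat m p) \<in> carrier_mat m m" by (auto simp: perm_mat_def)
  have "(mat_adjoint (perm_mat m p) * mat_diag m f * perm_mat m p) $$ (i, j)
      = (\<Sum>k = 0..<m. cnj (perm_mat m p $$ (k, i)) * f k * perm_mat m p $$ (k, j))"
    unfolding mat_diag_mult_right[OF c] using assms
    by (simp add: scalar_prod_def perm_mat_def)
  also have "\<dots> = (\<Sum>k = 0..<m. if k = p i then (if i = j then f (p i) else 0) else 0)"
    using assms pl inj by (intro sum.cong) (auto simp: perm_mat_def)
  also have "\<dots> = (if i = j then f (p i) else 0)" using pl by simp
  finally show ?thesis .
qed

text \<open>For the constant diagonal one, the conjugation formula is the orthonormality of the
  columns.\<close>

lemma unitary_perm_mat:
  assumes "p permutes {..<m}"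
  shows "unitary_mat m (perm_mat m p)"
proof (rule unitary_matI)
  have "mat_adjoint (perm_mat m p) * mat_diag m (\<lambda>_. 1) * perm_mat m p = 1\<^sub>m m"
    using perm_mat_conj_index[OF assms] by (intro eq_matI) (auto simp: perm_mat_def simp del: mat_diag_one index_mult_mat(1))
  then show "mat_adjoint (perm_mat m p) * perm_mat m p = 1\<^sub>m m"
    by (simp add: perm_mat_def)
qed (auto simp: perm_mat_def)

lemma mat_diag_permute:
  assumes "p permutes {..<m}"
  shows "mat_diag m (f \<circ> p) = mat_adjoint (perm_mat m p) * mat_diag m f * perm_mat m p"
  using perm_mat_conj_index[OF assms]
  by (intro eq_matI) (auto simp: perm_mat_def simp del: index_mult_mat(1))

lemma unitary_conj_cancel:
  assumes "unitary_mat m U" "D \<in> carrier_mat m m"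
  shows "mat_adjoint U * (U * D * mat_adjoint U) * U = D"
proof -
  note U = unitary_matD[OF assms(1)]
  have "mat_adjoint U * (U * D * mat_adjoint U) * U = mat_adjoint U * (U * (D * mat_adjoint U)) * U"
    using U(1) assms(2) by (subst assoc_mult_mat[of U m m D m _ m]) auto
  also have "mat_adjoint U * (U * (D * mat_adjoint U)) = D * mat_adjoint U"
    using U assms(2) by (intro mult_cancel_left_inverse[of _ _ m _ m]) auto
  also have "D * mat_adjoint U * U = D * (mat_adjoint U * U)"
    using U(1) assms(2) by (intro assoc_mult_mat[of _ m m _ m _ m]) auto
  finally show ?thesis using U assms(2) by simp
qed

lemma unitary_diag_permute:
  assumes U: "unitary_mat n U" and p: "p permutes {..<n}"
  shows "U * mat_diag n f * mat_adjoint U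
    = (U * perm_mat n p) * mat_diag n (f \<circ> p) * mat_adjoint (U * perm_mat n p)"
proof -
  let ?P = "perm_mat n p"
  note P = unitary_perm_mat[OF p]
  note Uc = unitary_matD(1)[OF U] and Pc = unitary_matD(1)[OF P]
  have D: "mat_diag n f = ?P * mat_diag n (f \<circ> p) * mat_adjoint ?P"
    unfolding mat_diag_permute[OF p]
    using unitary_conj_cancel[OF unitary_mat_adjoint[OF P], of "mat_diag n f", symmetric]
    by (simp only: mat_adjoint_adjoint mat_diag_dim)
  show ?thesis
    unfolding D using Uc Pc
    by (simp add: mat_adjoint_mult[of _ n n _ n] assoc_mult_mat[of _ n n _ n _ n]
        mult_carrier_mat[of _ n n _ n])
qed

section \<open>The spectral theorem for Hermitian matrices\<close>

text \<open>After completion of \<open>v\<close> to a basis, Gram-Schmidt keeps \<open>v\<close> as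
  the head of an orthogonal family; dividing by the lengths \<open>sqrt (r j)\<close> turns this
  family into the columns of a unitary matrix.\<close>

lemma unitary_with_first_column:
  fixes v :: "complex vec"
  assumes v: "v \<in> carrier_vec n" and v0: "v \<noteq> 0\<^sub>v n" and n: "n > 0"
  shows "\<exists>U c. unitary_mat n U \<and> col U 0 = c \<cdot>\<^sub>v v"
proof -
  interpret cof_vec_space n "TYPE(complex)" .
  define ws where "ws = gram_schmidt n (basis_completion v)"
  note bc = basis_completion[OF v v0]
  from bc(6,7) n obtain vs where bv: "basis_completion v = v # vs"
    by (cases "basis_completion v") auto
  from gram_schmidt_result[OF bc(2,4,5) refl, folded ws_def] bc(6)
  have ws: "set ws \<subseteq> carrier_vec n" "corthogonal ws" "length ws = n" by auto
  have hd: "hd ws = v" using gram_schmidt_hd[OF v, of vs] by (simp add: ws_def bv)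
  have wsc: "ws ! i \<in> carrier_vec n" if "i < n" for i using ws that by auto
  have ws0: "ws ! 0 = v" using hd n ws(3) by (metis hd_conv_nth length_0_conv less_irrefl)
  define r where "r i = Re (ws ! i \<bullet>c ws ! i)" for i
  have sq: "ws ! i \<bullet>c ws ! i = complex_of_real (r i)" and rpos: "r i > 0" if "i < n" for i
  proof -
    have nz: "ws ! i \<bullet>c ws ! i \<noteq> 0" using corthogonalD[OF ws(2), of i i] that ws(3) by auto
    have "ws ! i \<bullet>c ws ! i \<ge> 0" by (rule conjugate_square_ge_0_vec)
    then have im: "Im (ws ! i \<bullet>c ws ! i) = 0" and re: "r i \<ge> 0"
      by (auto simp: less_eq_complex_def r_def)
    show eq: "ws ! i \<bullet>c ws ! i = complex_of_real (r i)"
      using im by (auto simp: r_def complex_eq_iff)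
    show "r i > 0" using re nz eq by (cases "r i = 0") auto
  qed
  define U where "U = mat n n (\<lambda>(i, j). (ws ! j) $ i / complex_of_real (sqrt (r j)))"
  have Uc: "U \<in> carrier_mat n n" by (auto simp: U_def)
  have "mat_adjoint U * U = 1\<^sub>m n"
  proof (rule eq_matI)
    fix i j assume "i < dim_row (1\<^sub>m n :: complex mat)" "j < dim_col (1\<^sub>m n :: complex mat)"
    then have ij: "i < n" "j < n" by auto
    have "(mat_adjoint U * U) $$ (i, j)
        = (\<Sum>k<n. cnj ((ws ! i) $ k / complex_of_real (sqrt (r i))) * ((ws ! j) $ k / complex_of_real (sqrt (r j))))"
      using ij by (auto simp: U_def scalar_prod_def lessThan_atLeast0)
    also have "\<dots> = (ws ! j \<bullet>c ws ! i) / (complex_of_real (sqrt (r i)) * complex_of_real (sqrt (r j)))"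
      using wsc[OF ij(1)] wsc[OF ij(2)]
      by (auto simp: scalar_prod_def lessThan_atLeast0 sum_divide_distrib mult_ac intro!: sum.cong)
    also have "\<dots> = (if i = j then 1 else 0)"
    proof (cases "i = j")
      case True
      have "complex_of_real (sqrt (r j)) * complex_of_real (sqrt (r j)) = complex_of_real (r j)"
        using rpos[OF ij(2)] by (simp flip: of_real_mult)
      then show ?thesis using True sq[OF ij(2)] rpos[OF ij(2)] by auto
    next
      case False
      then show ?thesis using corthogonalD[OF ws(2), of j i] ij ws(3) by auto
    qed
    finally show "(mat_adjoint U * U) $$ (i, j) = 1\<^sub>m n $$ (i, j)" using ij by auto
  qed (use Uc in auto)
  then have "unitary_mat n U" using Uc by (rule unitary_matI[rotated])
  moreover have "col U 0 = (1 / complex_of_real (sqrt (r 0))) \<cdot>\<^sub>v v"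
    using n v by (auto simp: U_def ws0)
  ultimately show ?thesis by blast
qed

text \<open>Deflation: in an orthonormal basis that starts with an eigenvector, the first column is
  a multiple of the first unit vector. Hermitian symmetry then clears the first row as well and
  makes the eigenvalue real, which leaves a Hermitian block of size \<open>k\<close>.\<close>

theorem hermitian_diagonalization:
  fixes A :: "complex mat"
  assumes "A \<in> carrier_mat n n" "mat_adjoint A = A"
  shows "\<exists>U f. unitary_mat n U \<and> A = U * mat_diag n (\<lambda>i. complex_of_real (f i)) * mat_adjoint U"
  using assms
proof (induction n arbitrary: A)
  case 0
  then show ?case
    by (intro exI[of _ "1\<^sub>m 0"] exI) (auto simp: unitary_mat_one)
next
  case (Suc k)
  let ?n = "Suc k"
  have A: "A \<in> carrier_mat ?n ?n" by fact
  obtain e v where ev: "eigenvector A v e"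
    using spectrum_non_empty[OF A] by (auto simp: spectrum_def eigenvalue_def)
  then have v: "v \<in> carrier_vec ?n" "v \<noteq> 0\<^sub>v ?n" "A *\<^sub>v v = e \<cdot>\<^sub>v v"
    using A by (auto simp: eigenvector_def)
  obtain U c where U: "unitary_mat ?n U" and U0: "col U 0 = c \<cdot>\<^sub>v v"
    using unitary_with_first_column[OF v(1,2)] by auto
  note Uc = unitary_matD[OF U]
  define B where "B = mat_adjoint U * A * U"
  have B: "B \<in> carrier_mat ?n ?n" using Uc A by (auto simp: B_def)
  have Bh: "mat_adjoint B = B"
    using Uc A Suc.prems(2)
    by (simp add: B_def mat_adjoint_mult[of _ ?n ?n _ ?n] assoc_mult_mat[of _ ?n ?n _ ?n _ ?n]
        mult_carrier_mat[of _ ?n ?n _ ?n])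
  have "col B 0 = mat_adjoint U *\<^sub>v (A *\<^sub>v col U 0)"
    using Uc A by (simp add: B_def assoc_mult_mat[of _ ?n ?n _ ?n _ ?n] col_mult2[of _ ?n ?n _ ?n]
        mult_carrier_mat[of _ ?n ?n _ ?n] del: col_mult)
  also have "A *\<^sub>v col U 0 = e \<cdot>\<^sub>v col U 0"
    using v A by (simp add: U0 mult_mat_vec smult_smult_assoc mult_ac)
  also have "mat_adjoint U *\<^sub>v (e \<cdot>\<^sub>v col U 0) = e \<cdot>\<^sub>v (mat_adjoint U *\<^sub>v col U 0)"
    using Uc by (intro mult_mat_vec[of _ ?n ?n] col_carrier_vec[of _ ?n _ ?n]) auto
  also have "mat_adjoint U *\<^sub>v col U 0 = col (mat_adjoint U * U) 0"
    using Uc by (intro col_mult2[symmetric, of _ ?n ?n _ ?n]) auto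
  also have "\<dots> = unit_vec ?n 0" using Uc by simp
  finally have colB: "col B 0 = e \<cdot>\<^sub>v unit_vec ?n 0" .
  have Bi0: "B $$ (i, 0) = (if i = 0 then e else 0)" if "i < ?n" for i
    using arg_cong[OF colB, of "\<lambda>v. v $ i"] B that by auto
  have Bsym: "B $$ (i, j) = cnj (B $$ (j, i))" if "i < ?n" "j < ?n" for i j
    using arg_cong[OF Bh, of "\<lambda>M. M $$ (i, j)"] B that by auto
  have B0i: "B $$ (0, i) = (if i = 0 then e else 0)" if "i < ?n" for i
    using Bsym[of 0 i] Bi0[OF that] Bi0[of 0] Bsym[of 0 0] that by auto
  have er: "e = complex_of_real (Re e)"
    using Bsym[of 0 0] Bi0[of 0] by (simp add: complex_eq_iff)
  define C where "C = mat k k (\<lambda>(i, j). B $$ (Suc i, Suc j))"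
  have C: "C \<in> carrier_mat k k" by (auto simp: C_def)
  have "mat_adjoint C = C" by (rule eq_matI) (auto simp: C_def Bsym[symmetric])
  from Suc.IH[OF C this] obtain V g where V: "unitary_mat k V"
    and CV: "C = V * mat_diag k (\<lambda>i. complex_of_real (g i)) * mat_adjoint V" by auto
  note Vc = unitary_matD[OF V]
  \<comment> \<open>Bordering \<open>V\<close> by a one diagonalises the trailing block without
    touching the eigenvector.\<close>
  define W where "W = four_block_mat (1\<^sub>m 1) (0\<^sub>m 1 k) (0\<^sub>m k 1) V"
  have W: "W \<in> carrier_mat ?n ?n" using Vc by (auto simp: W_def)
  have adjW: "mat_adjoint W = four_block_mat (1\<^sub>m 1) (0\<^sub>m 1 k) (0\<^sub>m k 1) (mat_adjoint V)"
    using Vc by (intro eq_matI) (auto simp: W_def)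
  have "mat_adjoint W * W = 1\<^sub>m ?n"
    unfolding adjW unfolding W_def using Vc
    by (subst mult_four_block_mat[of _ 1 1 _ k _ k _ _ 1 _ k]) auto
  then have Wu: "unitary_mat ?n W" using W by (rule unitary_matI[rotated])
  define f where "f i = (case i of 0 \<Rightarrow> Re e | Suc j \<Rightarrow> g j)" for i
  have D: "mat_diag ?n (\<lambda>i. complex_of_real (f i))
      = four_block_mat (mat 1 1 (\<lambda>_. e)) (0\<^sub>m 1 k) (0\<^sub>m k 1) (mat_diag k (\<lambda>i. complex_of_real (g i)))"
    by (rule eq_matI) (auto simp: f_def er[symmetric] split: nat.splits)
  have "B = four_block_mat (mat 1 1 (\<lambda>_. e)) (0\<^sub>m 1 k) (0\<^sub>m k 1) C"
  proof (rule eq_matI)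
    fix i j
    assume "i < dim_row (four_block_mat (mat 1 1 (\<lambda>_. e)) (0\<^sub>m 1 k) (0\<^sub>m k 1) C)"
      "j < dim_col (four_block_mat (mat 1 1 (\<lambda>_. e)) (0\<^sub>m 1 k) (0\<^sub>m k 1) C)"
    then have "i < ?n" "j < ?n" using C by auto
    then show "B $$ (i, j) = four_block_mat (mat 1 1 (\<lambda>_. e)) (0\<^sub>m 1 k) (0\<^sub>m k 1) C $$ (i, j)"
      using C Bi0 B0i by (cases i; cases j) (auto simp: C_def)
  qed (use B C in auto)
  also have "\<dots> = W * mat_diag ?n (\<lambda>i. complex_of_real (f i)) * mat_adjoint W"
    unfolding D adjW unfolding W_def using Vc
    by (simp add: mult_four_block_mat[of _ 1 1 _ k _ k _ _ 1 _ k] CV mult_carrier_mat[of _ k k _ k])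
  finally have BW: "B = W * mat_diag ?n (\<lambda>i. complex_of_real (f i)) * mat_adjoint W" .
  have "A = U * B * mat_adjoint U"
    using unitary_conj_cancel[OF unitary_mat_adjoint[OF U] A] by (simp add: B_def)
  also have "\<dots> = (U * W) * mat_diag ?n (\<lambda>i. complex_of_real (f i)) * mat_adjoint (U * W)"
    using Uc W by (simp add: BW mat_adjoint_mult[of _ ?n ?n _ ?n] assoc_mult_mat[of _ ?n ?n _ ?n _ ?n]
        mult_carrier_mat[of _ ?n ?n _ ?n])
  finally show ?case using unitary_mat_mult[OF U Wu] by blast
qed

section \<open>Majorization\<close>

text \<open>Moving the mass \<open>\<delta>\<close> from an excessive \<open>c\<^sub>j\<close> to a deficient \<open>c\<^sub>k\<close> yields a convex combination of \<open>c\<close>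
  and \<open>c \<circ> transpose j k\<close> that agrees with \<open>y\<close> in one more place.\<close>

theorem majorization_symmetric_convex_le:
  fixes \<Phi> :: "(nat \<Rightarrow> real) \<Rightarrow> real"
  assumes cong: "\<And>x y. (\<And>i. i < m \<Longrightarrow> x i = y i) \<Longrightarrow> \<Phi> x = \<Phi> y"
    and swap: "\<And>x j k. j < m \<Longrightarrow> k < m \<Longrightarrow> \<Phi> (x \<circ> transpose j k) = \<Phi> x"
    and convex: "\<And>x y u. 0 \<le> u \<Longrightarrow> u \<le> 1 \<Longrightarrow>
      \<Phi> (\<lambda>i. (1 - u) * x i + u * y i) \<le> (1 - u) * \<Phi> x + u * \<Phi> y"
    and sorted: "\<And>i j. i \<le> j \<Longrightarrow> j < m \<Longrightarrow> y j \<le> y i"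
    and part: "\<And>k. k \<le> m \<Longrightarrow> sum y {..<k} \<le> sum c {..<k}"
    and total: "sum y {..<m} = sum c {..<m}"
  shows "\<Phi> y \<le> \<Phi> c"
  using part total
proof (induction "card {i. i < m \<and> y i \<noteq> c i}" arbitrary: c rule: less_induct)
  case less
  show ?case
  proof (cases "\<forall>i<m. y i = c i")
    case True
    then show ?thesis using cong[of y c] by auto
  next
    case False
    have "\<exists>k<m. y k > c k"
    proof (rule ccontr)
      assume "\<not> ?thesis"
      then have le: "\<forall>i\<in>{..<m}. y i \<le> c i" by (metis lessThan_iff not_less)
      moreover have "\<exists>i\<in>{..<m}. y i < c i" using False le by force
      ultimately have "sum y {..<m} < sum c {..<m}" by (intro sum_strict_mono_ex1) auto
      then show False using less.prems by simp
    qed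
    \<comment> \<open>At the first deficient place \<open>k\<close>, all earlier terms
      \<open>c i - y i\<close> are non-negative. This keeps the partial sums that end between
      \<open>j\<close> and \<open>k\<close> above those of \<open>y\<close> once
      \<open>\<delta>\<close> has been moved.\<close>
    define k where "k = (LEAST k. k < m \<and> y k > c k)"
    have k: "k < m" "y k > c k"
      using LeastI_ex[OF \<open>\<exists>k<m. y k > c k\<close>] unfolding k_def by auto
    have below: "y i \<le> c i" if "i < k" for i
      using not_less_Least[of i "\<lambda>k. k < m \<and> y k > c k"] that k by (auto simp: k_def[symmetric])
    have "\<exists>j<k. y j < c j"
    proof (rule ccontr)
      assume "\<not> ?thesis"
      then have "sum y {..<k} = sum c {..<k}" using below
        by (intro sum.cong refl) (metis lessThan_iff not_less order_antisym)
      then show False using less.prems(1)[of "Suc k"] k by simp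
    qed
    define j where "j = Max {j. j < k \<and> y j < c j}"
    have "j \<in> {j. j < k \<and> y j < c j}"
      unfolding j_def using \<open>\<exists>j<k. y j < c j\<close> by (intro Max_in) auto
    then have j: "j < k" "y j < c j" by auto
    define \<delta> where "\<delta> = min (c j - y j) (y k - c k)"
    have \<delta>: "\<delta> > 0" "\<delta> \<le> c j - y j" "\<delta> \<le> y k - c k" using j k by (auto simp: \<delta>_def)
    have ykj: "y k \<le> y j" using sorted[of j k] j k by auto
    \<comment> \<open>With this weight, mixing \<open>c\<close> with its swapped copy moves exactly
      \<open>\<delta>\<close>. As \<open>c j\<close> exceeds \<open>y j\<close> by at least
      \<open>\<delta>\<close>, \<open>c k\<close> lies below \<open>y k\<close>, and
      \<open>y k \<le> y j\<close>, the denominator is at least \<open>\<delta>\<close>.\<close>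
    define u where "u = \<delta> / (c j - c k)"
    have den: "c j - c k \<ge> \<delta>" "c j - c k > 0" using \<delta> ykj by linarith+
    have u: "0 \<le> u" "u \<le> 1" "u * (c j - c k) = \<delta>" using den \<delta> by (auto simp: u_def)
    define c' where "c' = c(j := c j - \<delta>, k := c k + \<delta>)"
    have c': "c' i = (1 - u) * c i + u * (c \<circ> transpose j k) i" for i
      using u j by (auto simp: c'_def transpose_def algebra_simps)
    have "\<Phi> c' \<le> (1 - u) * \<Phi> c + u * \<Phi> (c \<circ> transpose j k)"
      using convex[OF u(1,2), of c "c \<circ> transpose j k"] cong[of c'] c' by (metis (no_types, lifting))
    also have "\<dots> = \<Phi> c" using swap[of j k c] j k by (simp add: algebra_simps)
    finally have le: "\<Phi> c' \<le> \<Phi> c" .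
    have sums: "sum c' {..<l} = sum c {..<l} - (if j < l then \<delta> else 0) + (if k < l then \<delta> else 0)" for l
    proof -
      have "sum c' {..<l} = (\<Sum>i<l. c i - (if i = j then \<delta> else 0) + (if i = k then \<delta> else 0))"
        using j by (intro sum.cong) (auto simp: c'_def)
      then show ?thesis by (simp add: sum.distrib sum_subtractf)
    qed
    have "\<Phi> y \<le> \<Phi> c'"
    proof (rule less.hyps)
      have "{i. i < m \<and> y i \<noteq> c' i} \<subset> {i. i < m \<and> y i \<noteq> c i}"
      proof
        show "{i. i < m \<and> y i \<noteq> c' i} \<subseteq> {i. i < m \<and> y i \<noteq> c i}"
          using j k by (auto simp: c'_def split: if_splits)
        have "y j = c' j \<or> y k = c' k" using j by (auto simp: c'_def \<delta>_def min_def)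
        then show "{i. i < m \<and> y i \<noteq> c' i} \<noteq> {i. i < m \<and> y i \<noteq> c i}" using j k by force
      qed
      then show "card {i. i < m \<and> y i \<noteq> c' i} < card {i. i < m \<and> y i \<noteq> c i}"
        by (intro psubset_card_mono) auto
      show "sum y {..<l} \<le> sum c' {..<l}" if "l \<le> m" for l
      proof (cases "j < l \<and> \<not> k < l")
        case True
        have "c j - y j \<le> (\<Sum>i<l. c i - y i)"
          using True below by (intro member_le_sum) auto
        then show ?thesis using True \<delta> by (simp add: sums sum_subtractf)
      next
        case False
        then show ?thesis using less.prems(1)[OF that] j by (auto simp: sums)
      qed
      show "sum y {..<m} = sum c' {..<m}" using less.prems(2) j k by (auto simp: sums)
    qed
    then show ?thesis using le by simp
  qed
qed

lemma ex_sorting_permutation: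
  fixes f :: "nat \<Rightarrow> real"
  shows "\<exists>p. p permutes {..<m} \<and> (\<forall>i j. i \<le> j \<longrightarrow> j < m \<longrightarrow> f (p j) \<le> f (p i))"
proof -
  let ?ys = "map f [0..<m]"
  let ?xs = "rev (sort ?ys)"
  have "mset ?xs = mset ?ys" by simp
  from mset_eq_permutation[OF this] obtain p
    where p: "p permutes {..<length ?ys}" "permute_list p ?ys = ?xs" .
  have pm: "p permutes {..<m}" using p(1) by simp
  have nth: "?xs ! i = f (p i)" if "i < m" for i
    using permute_list_nth[OF p(1), of i] that permutes_in_image[OF pm, of i] by (simp add: p(2))
  have "f (p j) \<le> f (p i)" if "i \<le> j" "j < m" for i j
  proof -
    have "?xs ! j \<le> ?xs ! i"
      using that by (simp add: rev_nth) (intro sorted_nth_mono, auto)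
    then show ?thesis using nth that by simp
  qed
  then show ?thesis using pm by blast
qed

section \<open>Weyl's monotonicity principle\<close>

theorem hermitian_diagonalization_sorted:
  fixes A :: "complex mat"
  assumes "A \<in> carrier_mat n n" "mat_adjoint A = A"
  shows "\<exists>U f. unitary_mat n U \<and> A = U * mat_diag n (\<lambda>i. complex_of_real (f i)) * mat_adjoint U \<and>
    (\<forall>i j. i \<le> j \<longrightarrow> j < n \<longrightarrow> f j \<le> f i)"
proof -
  obtain U f where U: "unitary_mat n U"
    and A: "A = U * mat_diag n (\<lambda>i. complex_of_real (f i)) * mat_adjoint U"
    using hermitian_diagonalization[OF assms] by blast
  obtain p where p: "p permutes {..<n}" "\<forall>i j. i \<le> j \<longrightarrow> j < n \<longrightarrow> f (p j) \<le> f (p i)"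
    using ex_sorting_permutation[of n f] by blast
  have "A = (U * perm_mat n p) * mat_diag n (\<lambda>i. complex_of_real ((f \<circ> p) i)) * mat_adjoint (U * perm_mat n p)"
    unfolding A using unitary_diag_permute[OF U p(1), of "\<lambda>i. complex_of_real (f i)"] by (simp only: comp_def)
  then show ?thesis using unitary_mat_mult[OF U unitary_perm_mat[OF p(1)]] p(2)
    by (intro exI[of _ "U * perm_mat n p"] exI[of _ "f \<circ> p"]) auto
qed

lemma cscalar_adjoint:
  fixes A :: "complex mat"
  assumes "A \<in> carrier_mat m n" "v \<in> carrier_vec n" "w \<in> carrier_vec m"
  shows "(A *\<^sub>v v) \<bullet>c w = v \<bullet>c (mat_adjoint A *\<^sub>v w)"
proof -
  have "(A *\<^sub>v v) \<bullet>c w = (\<Sum>i = 0..<m. \<Sum>j = 0..<n. A $$ (i, j) * v $ j * cnj (w $ i))"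
    using assms by (auto simp: scalar_prod_def sum_distrib_right intro!: sum.cong)
  also have "\<dots> = (\<Sum>j = 0..<n. \<Sum>i = 0..<m. A $$ (i, j) * v $ j * cnj (w $ i))"
    by (rule sum.swap)
  also have "\<dots> = v \<bullet>c (mat_adjoint A *\<^sub>v w)"
    using assms by (auto simp: scalar_prod_def sum_distrib_left mult_ac intro!: sum.cong)
  finally show ?thesis .
qed

lemma Re_cscalar_self: "Re (v \<bullet>c v) = (\<Sum>i<dim_vec v. (cmod (v $ i))\<^sup>2)"
  by (simp add: scalar_prod_def lessThan_atLeast0 complex_mult_cnj cmod_power2)

lemma mat_diag_mult_vec:
  assumes "i < m" "z \<in> carrier_vec m"
  shows "(mat_diag m f *\<^sub>v z) $ i = f i * z $ i"
proof -
  have "(mat_diag m f *\<^sub>v z) $ i = (\<Sum>j = 0..<m. (if i = j then f i else 0) * z $ j)"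
    using assms by (simp add: scalar_prod_def)
  also have "\<dots> = (\<Sum>j = 0..<m. if j = i then f i * z $ i else 0)" by (intro sum.cong) auto
  finally show ?thesis using assms by simp
qed

lemma quadratic_form_unitary_diag:
  assumes U: "unitary_mat m U" and v: "v \<in> carrier_vec m"
  shows "Re ((U * mat_diag m (\<lambda>i. complex_of_real (a i)) * mat_adjoint U *\<^sub>v v) \<bullet>c v)
    = (\<Sum>i<m. a i * (cmod ((mat_adjoint U *\<^sub>v v) $ i))\<^sup>2)"
proof -
  note Uc = unitary_matD[OF U]
  define z where "z = mat_adjoint U *\<^sub>v v"
  have z: "z \<in> carrier_vec m" using Uc v by (auto simp: z_def)
  let ?D = "mat_diag m (\<lambda>i. complex_of_real (a i))"
  have "U * ?D * mat_adjoint U *\<^sub>v v = U *\<^sub>v (?D *\<^sub>v z)"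
    using Uc v by (simp add: z_def assoc_mult_mat_vec[of _ m m _ m])
  then have "(U * ?D * mat_adjoint U *\<^sub>v v) \<bullet>c v = (?D *\<^sub>v z) \<bullet>c z"
    using cscalar_adjoint[OF Uc(1) mult_mat_vec_carrier[OF mat_diag_dim z] v] by (simp only: z_def)
  also have "\<dots> = (\<Sum>i<m. complex_of_real (a i * (cmod (z $ i))\<^sup>2))"
  proof -
    have "(?D *\<^sub>v z) $ i = complex_of_real (a i) * z $ i" if "i < m" for i
      using that z by (intro mat_diag_mult_vec) auto
    moreover have "(complex_of_real (cmod w))\<^sup>2 = w * cnj w" for w
      by (metis complex_norm_square of_real_power)
    ultimately show ?thesis using z
      by (auto simp: scalar_prod_def lessThan_atLeast0 mult_ac simp del: index_mult_mat_vec intro!: sum.cong)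
  qed
  finally show ?thesis by (simp add: z_def)
qed

lemma norm_unitary:
  assumes U: "unitary_mat m U" and v: "v \<in> carrier_vec m"
  shows "Re (v \<bullet>c v) = (\<Sum>i<m. (cmod ((mat_adjoint U *\<^sub>v v) $ i))\<^sup>2)"
proof -
  have "U * mat_diag m (\<lambda>i. complex_of_real 1) * mat_adjoint U = 1\<^sub>m m"
    using unitary_matD[OF U] by simp
  then show ?thesis using quadratic_form_unitary_diag[OF U v, of "\<lambda>_. 1"] v by simp
qed

text \<open>A dimension count as in Courant-Fischer: the first \<open>j + 1\<close> columns of
  \<open>U\<close> and the columns of \<open>V\<close> from index \<open>j\<close> on span spaces
  whose dimensions add up to \<open>m + 1\<close>, so they share a non-zero \<open>v\<close>. There
  the left form is at least \<open>a j\<close> and the right one at most \<open>e j + t\<close>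
  times the square of the length of \<open>v\<close>.\<close>

theorem weyl_monotonicity:
  assumes U: "unitary_mat m U" and V: "unitary_mat m V"
    and a: "\<And>i j. i \<le> j \<Longrightarrow> j < m \<Longrightarrow> a j \<le> a i"
    and e: "\<And>i j. i \<le> j \<Longrightarrow> j < m \<Longrightarrow> e j \<le> e i"
    and le: "\<And>v. v \<in> carrier_vec m \<Longrightarrow>
      Re ((U * mat_diag m (\<lambda>i. complex_of_real (a i)) * mat_adjoint U *\<^sub>v v) \<bullet>c v)
      \<le> Re ((V * mat_diag m (\<lambda>i. complex_of_real (e i)) * mat_adjoint V *\<^sub>v v) \<bullet>c v) + t * Re (v \<bullet>c v)"
    and j: "j < m"
  shows "a j \<le> e j + t"
proof -
  note Uc = unitary_matD[OF U] and Vc = unitary_matD[OF V]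
  define W where "W = mat_adjoint V * U"
  have W: "W \<in> carrier_mat m m" using Uc Vc by (auto simp: W_def)
  \<comment> \<open>Row \<open>j\<close> of \<open>R\<close> vanishes, so \<open>R\<close> has a kernel vector \<open>x\<close>: it is supported on the first \<open>j + 1\<close>
    coordinates, while \<open>W x\<close> vanishes on the first \<open>j\<close> ones.\<close>
  define R where "R = mat\<^sub>r m m (\<lambda>i. if i = j then 0\<^sub>v m else if i < j then row W i else unit_vec m i)"
  have "det R = 0" unfolding R_def
    using W by (intro det_row_0[OF j]) auto
  moreover have R: "R \<in> carrier_mat m m" by (auto simp: R_def)
  ultimately obtain x where x: "x \<in> carrier_vec m" "x \<noteq> 0\<^sub>v m" "R *\<^sub>v x = 0\<^sub>v m"
    using det_0_iff_vec_prod_zero_field[OF R] by auto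
  have Rx: "row R i \<bullet> x = 0" if "i < m" for i
    using arg_cong[OF x(3), of "\<lambda>v. v $ i"] that R by auto
  have x_high: "x $ i = 0" if "j < i" "i < m" for i
    using Rx[OF that(2)] that x by (simp add: R_def)
  have Wx_low: "(W *\<^sub>v x) $ i = 0" if "i < j" for i
    using Rx[of i] that j W by (simp add: R_def)
  define v where "v = U *\<^sub>v x"
  have v: "v \<in> carrier_vec m" using Uc x by (auto simp: v_def)
  have Ux: "mat_adjoint U *\<^sub>v v = x"
    using Uc x by (simp add: v_def assoc_mult_mat_vec[symmetric, of _ m m _ m] del: assoc_mult_mat_vec)
  have Vx: "mat_adjoint V *\<^sub>v v = W *\<^sub>v x"
    using Uc Vc x by (simp add: v_def W_def)
  define nv where "nv = Re (v \<bullet>c v)"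
  have nx: "nv = (\<Sum>i<m. (cmod (x $ i))\<^sup>2)" unfolding nv_def
    using norm_unitary[OF U v] by (simp add: Ux)
  have nW: "nv = (\<Sum>i<m. (cmod ((W *\<^sub>v x) $ i))\<^sup>2)" unfolding nv_def
    using norm_unitary[OF V v] by (simp only: Vx)
  have "\<exists>i<m. x $ i \<noteq> 0" using x by (metis eq_vecI carrier_vecD index_zero_vec)
  then obtain i0 where i0: "i0 < m" "x $ i0 \<noteq> 0" by blast
  have pos: "nv > 0" unfolding nx
    by (rule sum_pos2[of _ i0]) (use i0 in auto)
  have "a j * nv = (\<Sum>i<m. a j * (cmod (x $ i))\<^sup>2)" by (simp add: nx sum_distrib_left)
  also have "\<dots> \<le> (\<Sum>i<m. a i * (cmod (x $ i))\<^sup>2)"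
  proof (rule sum_mono)
    fix i assume "i \<in> {..<m}"
    then show "a j * (cmod (x $ i))\<^sup>2 \<le> a i * (cmod (x $ i))\<^sup>2"
      using a[of i j] x_high[of i] j by (cases "i \<le> j") (auto intro: mult_right_mono)
  qed
  also have "\<dots> \<le> (\<Sum>i<m. e i * (cmod ((W *\<^sub>v x) $ i))\<^sup>2) + t * nv"
    using le[OF v] unfolding quadratic_form_unitary_diag[OF U v] quadratic_form_unitary_diag[OF V v]
    unfolding Ux Vx nv_def .
  also have "(\<Sum>i<m. e i * (cmod ((W *\<^sub>v x) $ i))\<^sup>2) \<le> (\<Sum>i<m. e j * (cmod ((W *\<^sub>v x) $ i))\<^sup>2)"
  proof (rule sum_mono)
    fix i assume "i \<in> {..<m}"
    then show "e i * (cmod ((W *\<^sub>v x) $ i))\<^sup>2 \<le> e j * (cmod ((W *\<^sub>v x) $ i))\<^sup>2"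
      using e[of j i] Wx_low[of i] j
      by (cases "j \<le> i") (auto intro: mult_right_mono simp del: index_mult_mat_vec)
  qed
  also have "(\<Sum>i<m. e j * (cmod ((W *\<^sub>v x) $ i))\<^sup>2) = e j * nv" by (simp only: nW sum_distrib_left)
  finally have "a j * nv \<le> (e j + t) * nv" by (simp add: algebra_simps)
  then show ?thesis using pos by simp
qed

lemma trace_unitary_conj:
  assumes U: "unitary_mat m U"
  shows "(\<Sum>i<m. (U * mat_diag m a * mat_adjoint U) $$ (i, i)) = (\<Sum>i<m. a i)"
proof -
  note Uc = unitary_matD[OF U]
  have "(\<Sum>i<m. (U * mat_diag m a * mat_adjoint U) $$ (i, i))
      = (\<Sum>i<m. \<Sum>k<m. U $$ (i, k) * a k * cnj (U $$ (i, k)))"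
    unfolding mat_diag_mult_right[OF Uc(1)] using Uc(1)
    by (auto simp: scalar_prod_def lessThan_atLeast0 intro!: sum.cong)
  also have "\<dots> = (\<Sum>k<m. \<Sum>i<m. U $$ (i, k) * a k * cnj (U $$ (i, k)))" by (rule sum.swap)
  also have "\<dots> = (\<Sum>k<m. a k * (mat_adjoint U * U) $$ (k, k))"
    using Uc(1) by (auto simp: scalar_prod_def lessThan_atLeast0 sum_distrib_left mult_ac intro!: sum.cong)
  also have "\<dots> = (\<Sum>k<m. a k)" using Uc(2) by simp
  finally show ?thesis .
qed

section \<open>Lidskii's theorem for unitarily invariant norms\<close>

lemma hermitian_unitary_diag:
  assumes "unitary_mat m U"
  shows "mat_adjoint (U * mat_diag m (\<lambda>i. complex_of_real (f i)) * mat_adjoint U)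
    = U * mat_diag m (\<lambda>i. complex_of_real (f i)) * mat_adjoint U"
  using unitary_matD(1)[OF assms]
  by (simp add: mat_adjoint_mult[of _ m m _ m] mult_carrier_mat[of _ m m _ m] assoc_mult_mat[of _ m m _ m _ m])

lemma Re_quadratic_add:
  fixes A B :: "complex mat"
  assumes "A \<in> carrier_mat m m" "B \<in> carrier_mat m m" "v \<in> carrier_vec m"
  shows "Re (((A + B) *\<^sub>v v) \<bullet>c v) = Re ((A *\<^sub>v v) \<bullet>c v) + Re ((B *\<^sub>v v) \<bullet>c v)"
proof -
  have "(A + B) *\<^sub>v v = A *\<^sub>v v + B *\<^sub>v v"
    using assms by (intro add_mult_distrib_mat_vec) auto
  then show ?thesis using assms by (simp add: add_scalar_prod_distrib[of _ m])
qed

lemma trace_unitary_conj_real: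
  assumes "unitary_mat m U"
  shows "Re (\<Sum>i<m. (U * mat_diag m (\<lambda>i. complex_of_real (f i)) * mat_adjoint U) $$ (i, i)) = (\<Sum>i<m. f i)"
  unfolding trace_unitary_conj[OF assms] by simp

text \<open>The argument of Li and Mathias: \<open>C = A - B\<close> is at most \<open>P + t\<close>, where \<open>P\<close> is the positive part
  of \<open>C - t\<close>, so that each \<open>a\<^sub>i - b\<^sub>i - t\<close> is at most the non-negative shift of the \<open>i\<close>-th eigenvalue
  from \<open>B\<close> to \<open>B + P\<close>, and these shifts sum to the trace of \<open>P\<close>.\<close>

lemma lidskii_threshold:
  fixes a b c :: "nat \<Rightarrow> real" and t :: real
  assumes U: "unitary_mat m U" and V: "unitary_mat m V" and W: "unitary_mat m W"
    and a: "\<And>i j. i \<le> j \<Longrightarrow> j < m \<Longrightarrow> a j \<le> a i"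
    and b: "\<And>i j. i \<le> j \<Longrightarrow> j < m \<Longrightarrow> b j \<le> b i"
    and C: "W * mat_diag m (\<lambda>i. complex_of_real (c i)) * mat_adjoint W
      = U * mat_diag m (\<lambda>i. complex_of_real (a i)) * mat_adjoint U
        - V * mat_diag m (\<lambda>i. complex_of_real (b i)) * mat_adjoint V"
  shows "(\<Sum>i<m. max 0 (a i - b i - t)) \<le> (\<Sum>i<m. max 0 (c i - t))"
proof -
  define p where "p i = max 0 (c i - t)" for i
  let ?A = "U * mat_diag m (\<lambda>i. complex_of_real (a i)) * mat_adjoint U"
  let ?B = "V * mat_diag m (\<lambda>i. complex_of_real (b i)) * mat_adjoint V"
  let ?C = "W * mat_diag m (\<lambda>i. complex_of_real (c i)) * mat_adjoint W"
  let ?P = "W * mat_diag m (\<lambda>i. complex_of_real (p i)) * mat_adjoint W"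
  note Uc = unitary_matD(1)[OF U] and Vc = unitary_matD(1)[OF V] and Wc = unitary_matD(1)[OF W]
  have A: "?A \<in> carrier_mat m m" and B: "?B \<in> carrier_mat m m"
    and Cc: "?C \<in> carrier_mat m m" and P: "?P \<in> carrier_mat m m"
    using Uc Vc Wc by (auto intro!: mult_carrier_mat[of _ m m _ m])
  have ABC: "?A = ?B + ?C" unfolding C using Uc Vc by (intro eq_matI) (auto simp del: index_mult_mat(1))
  have "mat_adjoint (?B + ?P) = ?B + ?P"
    using B P by (simp add: mat_adjoint_add[of _ m m] hermitian_unitary_diag V W)
  then obtain X e where X: "unitary_mat m X"
    and E: "?B + ?P = X * mat_diag m (\<lambda>i. complex_of_real (e i)) * mat_adjoint X"
    and e: "\<forall>i j. i \<le> j \<longrightarrow> j < m \<longrightarrow> e j \<le> e i"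
    using hermitian_diagonalization_sorted[of "?B + ?P" m] B P by (meson add_carrier_mat)
  have e': "e j \<le> e i" if "i \<le> j" "j < m" for i j using e that by blast
  have be: "b j \<le> e j" if "j < m" for j
  proof -
    have "b j \<le> e j + 0"
    proof (rule weyl_monotonicity[OF V X b e' _ that])
      fix v :: "complex vec" assume v: "v \<in> carrier_vec m"
      have "Re ((?P *\<^sub>v v) \<bullet>c v) \<ge> 0"
        unfolding quadratic_form_unitary_diag[OF W v] by (intro sum_nonneg) (auto simp: p_def)
      then show "Re ((?B *\<^sub>v v) \<bullet>c v)
          \<le> Re ((X * mat_diag m (\<lambda>i. complex_of_real (e i)) * mat_adjoint X *\<^sub>v v) \<bullet>c v) + 0 * Re (v \<bullet>c v)"
        unfolding E[symmetric] Re_quadratic_add[OF B P v] by linarith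
    qed
    then show ?thesis by simp
  qed
  have ae: "a j \<le> e j + t" if "j < m" for j
  proof (rule weyl_monotonicity[OF U X a e' _ that])
    fix v :: "complex vec" assume v: "v \<in> carrier_vec m"
    have "Re ((?C *\<^sub>v v) \<bullet>c v) \<le> Re ((?P *\<^sub>v v) \<bullet>c v) + t * Re (v \<bullet>c v)"
      unfolding quadratic_form_unitary_diag[OF W v] norm_unitary[OF W v] sum_distrib_left sum.distrib[symmetric]
    proof (rule sum_mono)
      fix i
      have "c i \<le> p i + t" by (auto simp: p_def)
      then show "c i * (cmod ((mat_adjoint W *\<^sub>v v) $ i))\<^sup>2
          \<le> p i * (cmod ((mat_adjoint W *\<^sub>v v) $ i))\<^sup>2 + t * (cmod ((mat_adjoint W *\<^sub>v v) $ i))\<^sup>2"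
        unfolding distrib_right[symmetric] by (rule mult_right_mono) simp
    qed
    then show "Re ((?A *\<^sub>v v) \<bullet>c v)
        \<le> Re ((X * mat_diag m (\<lambda>i. complex_of_real (e i)) * mat_adjoint X *\<^sub>v v) \<bullet>c v) + t * Re (v \<bullet>c v)"
      unfolding E[symmetric] ABC Re_quadratic_add[OF B P v] Re_quadratic_add[OF B Cc v] by linarith
  qed
  have "(\<Sum>i<m. max 0 (a i - b i - t)) \<le> (\<Sum>i<m. e i - b i)"
  proof (rule sum_mono)
    fix i assume "i \<in> {..<m}"
    then have "a i \<le> e i + t" "b i \<le> e i" using ae be by auto
    then show "max 0 (a i - b i - t) \<le> e i - b i" by simp
  qed
  also have "\<dots> = Re (\<Sum>i<m. (?B + ?P) $$ (i, i)) - (\<Sum>i<m. b i)"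
    unfolding E trace_unitary_conj_real[OF X] by (simp add: sum_subtractf)
  also have "Re (\<Sum>i<m. (?B + ?P) $$ (i, i)) = Re (\<Sum>i<m. ?B $$ (i, i)) + Re (\<Sum>i<m. ?P $$ (i, i))"
    using Vc Wc by (simp add: sum.distrib del: index_mult_mat(1))
  also have "\<dots> = (\<Sum>i<m. b i) + (\<Sum>i<m. p i)"
    unfolding trace_unitary_conj_real[OF V] trace_unitary_conj_real[OF W] ..
  finally show ?thesis by (simp add: p_def)
qed

lemma uin_add:
  assumes "unitarily_invariant_norm m N" "A \<in> carrier_mat m m" "B \<in> carrier_mat m m"
  shows "N (A + B) \<le> N A + N B"
  using assms by (auto simp: unitarily_invariant_norm_def mat_norm_def)

lemma uin_smult:
  assumes "unitarily_invariant_norm m N" "A \<in> carrier_mat m m"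
  shows "N (c \<cdot>\<^sub>m A) = cmod c * N A"
  using assms by (auto simp: unitarily_invariant_norm_def mat_norm_def)

lemma uin_nonneg:
  assumes "unitarily_invariant_norm m N" "A \<in> carrier_mat m m"
  shows "N A \<ge> 0"
  using assms by (auto simp: unitarily_invariant_norm_def mat_norm_def)

lemma uin_unitary:
  assumes "unitarily_invariant_norm m N" "A \<in> carrier_mat m m" "unitary_mat m U" "unitary_mat m V"
  shows "N (U * A * V) = N A"
  using assms by (auto simp: unitarily_invariant_norm_def)

lemma uin_unitary_left:
  assumes "unitarily_invariant_norm m N" "A \<in> carrier_mat m m" "unitary_mat m U"
  shows "N (U * A) = N A"
  using uin_unitary[OF assms unitary_mat_one] assms(2) unitary_matD(1)[OF assms(3)] by simp

lemma uin_unitary_right: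
  assumes "unitarily_invariant_norm m N" "A \<in> carrier_mat m m" "unitary_mat m U"
  shows "N (A * U) = N A"
  using uin_unitary[OF assms(1,2) unitary_mat_one assms(3)] assms(2) by simp

text \<open>On diagonal matrices the norm is a convex function of the diagonal that is symmetric
  under permutations. It is therefore enough that the sorted differences \<open>a i - b i\<close>
  are majorized by the eigenvalues \<open>c\<close> of the difference; the threshold inequality
  gives the partial sums and the trace gives the total.\<close>

theorem lidskii_unitarily_invariant:
  assumes N: "unitarily_invariant_norm m N"
    and U: "unitary_mat m U" and V: "unitary_mat m V"
    and a: "\<And>i j. i \<le> j \<Longrightarrow> j < m \<Longrightarrow> a j \<le> a i"
    and b: "\<And>i j. i \<le> j \<Longrightarrow> j < m \<Longrightarrow> b j \<le> b i"
  shows "N (mat_diag m (\<lambda>i. complex_of_real (a i - b i)))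
    \<le> N (U * mat_diag m (\<lambda>i. complex_of_real (a i)) * mat_adjoint U
        - V * mat_diag m (\<lambda>i. complex_of_real (b i)) * mat_adjoint V)"
proof -
  let ?A = "U * mat_diag m (\<lambda>i. complex_of_real (a i)) * mat_adjoint U"
  let ?B = "V * mat_diag m (\<lambda>i. complex_of_real (b i)) * mat_adjoint V"
  note Uc = unitary_matD(1)[OF U] and Vc = unitary_matD(1)[OF V]
  have A: "?A \<in> carrier_mat m m" and B: "?B \<in> carrier_mat m m"
    using Uc Vc by (auto intro!: mult_carrier_mat[of _ m m _ m])
  have AB: "?A - ?B \<in> carrier_mat m m" using B by (rule minus_carrier_mat)
  have "mat_adjoint (?A - ?B) = ?A - ?B"
    unfolding mat_adjoint_minus[OF A B] by (simp only: hermitian_unitary_diag U V)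
  then obtain W c where W: "unitary_mat m W"
    and C: "?A - ?B = W * mat_diag m (\<lambda>i. complex_of_real (c i)) * mat_adjoint W"
    and c: "\<forall>i j. i \<le> j \<longrightarrow> j < m \<longrightarrow> c j \<le> c i"
    using hermitian_diagonalization_sorted[OF AB] by blast
  define y where "y i = a i - b i" for i
  obtain p where p: "p permutes {..<m}"
    and yp: "\<forall>i j. i \<le> j \<longrightarrow> j < m \<longrightarrow> y (p j) \<le> y (p i)"
    using ex_sorting_permutation[of m y] by blast
  define \<Phi> where "\<Phi> x = N (mat_diag m (\<lambda>i. complex_of_real (x i)))" for x :: "nat \<Rightarrow> real"
  have \<Phi>_perm: "\<Phi> (x \<circ> q) = \<Phi> x" if "q permutes {..<m}" for q x
  proof -
    have "mat_diag m (\<lambda>i. complex_of_real ((x \<circ> q) i))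
        = mat_adjoint (perm_mat m q) * mat_diag m (\<lambda>i. complex_of_real (x i)) * perm_mat m q"
      using mat_diag_permute[OF that, of "\<lambda>i. complex_of_real (x i)"] by (simp add: comp_def)
    then show ?thesis unfolding \<Phi>_def
      using uin_unitary[OF N mat_diag_dim unitary_mat_adjoint[OF unitary_perm_mat[OF that]] unitary_perm_mat[OF that]]
      by simp
  qed
  have "\<Phi> (y \<circ> p) \<le> \<Phi> c"
  proof (rule majorization_symmetric_convex_le[where m = m and \<Phi> = \<Phi> and y = "y \<circ> p" and c = c])
    show "\<Phi> x = \<Phi> z" if "\<And>i. i < m \<Longrightarrow> x i = z i" for x z :: "nat \<Rightarrow> real"
      unfolding \<Phi>_def using that by (intro arg_cong[of _ _ N] mat_diag_cong) auto
    show "\<Phi> (x \<circ> transpose j k) = \<Phi> x" if "j < m" "k < m" for x :: "nat \<Rightarrow> real" and j k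
      using that by (intro \<Phi>_perm permutes_swap_id) auto
    show "\<Phi> (\<lambda>i. (1 - u) * x i + u * z i) \<le> (1 - u) * \<Phi> x + u * \<Phi> z" if "0 \<le> u" "u \<le> 1" for u and x z :: "nat \<Rightarrow> real"
    proof -
      have "mat_diag m (\<lambda>i. complex_of_real ((1 - u) * x i + u * z i))
          = complex_of_real (1 - u) \<cdot>\<^sub>m mat_diag m (\<lambda>i. complex_of_real (x i))
            + complex_of_real u \<cdot>\<^sub>m mat_diag m (\<lambda>i. complex_of_real (z i))"
        by (intro eq_matI) auto
      then have "\<Phi> (\<lambda>i. (1 - u) * x i + u * z i)
          \<le> N (complex_of_real (1 - u) \<cdot>\<^sub>m mat_diag m (\<lambda>i. complex_of_real (x i)))
            + N (complex_of_real u \<cdot>\<^sub>m mat_diag m (\<lambda>i. complex_of_real (z i)))"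
        unfolding \<Phi>_def by (auto intro!: uin_add[OF N])
      also have "\<dots> = (1 - u) * \<Phi> x + u * \<Phi> z"
        unfolding uin_smult[OF N mat_diag_dim] norm_of_real \<Phi>_def using that by simp
      finally show ?thesis .
    qed
    show "(y \<circ> p) j \<le> (y \<circ> p) i" if "i \<le> j" "j < m" for i j using yp that by auto
    have sum_p: "(\<Sum>i<m. f ((y \<circ> p) i)) = (\<Sum>i<m. f (y i))" for f :: "real \<Rightarrow> real"
      using sum.permute[OF p, of "\<lambda>i. f (y i)"] by (simp add: comp_def)
    show "sum (y \<circ> p) {..<k} \<le> sum c {..<k}" if "k \<le> m" for k
    proof (cases k)
      case (Suc l)
      \<comment> \<open>The threshold is the \<open>k\<close>-th largest eigenvalue, since indices
        start at zero. Then \<open>max 0 (c i - t)\<close> is \<open>c i - t\<close> for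
        \<open>i < k\<close> and zero afterwards, so the shift \<open>k * t\<close> cancels.\<close>
      define t where "t = c l"
      have "sum (y \<circ> p) {..<k} - k * t = (\<Sum>i<k. (y \<circ> p) i - t)" by (simp add: sum_subtractf)
      also have "\<dots> \<le> (\<Sum>i<k. max 0 ((y \<circ> p) i - t))" by (intro sum_mono) auto
      also have "\<dots> \<le> (\<Sum>i<m. max 0 ((y \<circ> p) i - t))" using that by (intro sum_mono2) auto
      also have "\<dots> = (\<Sum>i<m. max 0 (y i - t))" by (rule sum_p)
      also have "\<dots> \<le> (\<Sum>i<m. max 0 (c i - t))"
        unfolding y_def by (rule lidskii_threshold[OF U V W a b C[symmetric]])
      also have "\<dots> = (\<Sum>i<k. max 0 (c i - t))"
        using that c Suc by (intro sum.mono_neutral_right) (auto simp: t_def not_less)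
      also have "\<dots> = (\<Sum>i<k. c i - t)"
        using that c Suc by (intro sum.cong) (auto simp: t_def less_Suc_eq_le max_def)
      also have "\<dots> = sum c {..<k} - k * t" by (simp add: sum_subtractf)
      finally show ?thesis by simp
    qed simp
    have "sum c {..<m} = Re (\<Sum>i<m. (?A - ?B) $$ (i, i))" unfolding C trace_unitary_conj_real[OF W] ..
    also have "\<dots> = Re (\<Sum>i<m. ?A $$ (i, i)) - Re (\<Sum>i<m. ?B $$ (i, i))"
      using Uc Vc by (simp add: sum_subtractf del: index_mult_mat(1))
    also have "\<dots> = sum y {..<m}"
      unfolding trace_unitary_conj_real[OF U] trace_unitary_conj_real[OF V] by (simp add: y_def sum_subtractf)
    finally show "sum (y \<circ> p) {..<m} = sum c {..<m}" using sum_p[of "\<lambda>x. x"] by simp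
  qed
  then have "\<Phi> y \<le> \<Phi> c" by (simp add: \<Phi>_perm[OF p])
  also have "\<Phi> c = N (?A - ?B)" unfolding C \<Phi>_def
    using uin_unitary[OF N mat_diag_dim W unitary_mat_adjoint[OF W]] by simp
  finally show ?thesis unfolding \<Phi>_def y_def .
qed

text \<open>Signed symplectic spectra are listed as all \<open>d\<close> followed by all
  \<open>- d\<close>, which is not a monotone order. A common sorting permutation can be absorbed
  into \<open>U\<close> and \<open>V\<close> while \<open>a i\<close> stays paired with
  \<open>b i\<close>.\<close>

lemma lidskii_simultaneously_sorted:
  assumes N: "unitarily_invariant_norm m N"
    and U: "unitary_mat m U" and V: "unitary_mat m V" and p: "p permutes {..<m}"
    and a: "\<And>i j. i \<le> j \<Longrightarrow> j < m \<Longrightarrow> a (p j) \<le> a (p i)"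
    and b: "\<And>i j. i \<le> j \<Longrightarrow> j < m \<Longrightarrow> b (p j) \<le> b (p i)"
  shows "N (mat_diag m (\<lambda>i. complex_of_real (a i - b i)))
    \<le> N (U * mat_diag m (\<lambda>i. complex_of_real (a i)) * mat_adjoint U
        - V * mat_diag m (\<lambda>i. complex_of_real (b i)) * mat_adjoint V)"
proof -
  let ?P = "perm_mat m p"
  note P = unitary_perm_mat[OF p]
  have "N (mat_diag m (\<lambda>i. complex_of_real (a i - b i))) = N (mat_diag m (\<lambda>i. complex_of_real (a (p i) - b (p i))))"
    using mat_diag_permute[OF p, of "\<lambda>i. complex_of_real (a i - b i)"]
      uin_unitary[OF N mat_diag_dim unitary_mat_adjoint[OF P] P]
    by (simp only: comp_def)
  also have "\<dots> \<le> N ((U * ?P) * mat_diag m (\<lambda>i. complex_of_real (a (p i))) * mat_adjoint (U * ?P)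
      - (V * ?P) * mat_diag m (\<lambda>i. complex_of_real (b (p i))) * mat_adjoint (V * ?P))"
    using a b by (intro lidskii_unitarily_invariant[OF N] unitary_mat_mult U V P)
  finally show ?thesis
    using unitary_diag_permute[OF U p, of "\<lambda>i. complex_of_real (a i)"]
      unitary_diag_permute[OF V p, of "\<lambda>i. complex_of_real (b i)"]
    by (simp only: comp_def)
qed

section \<open>Singular values and contractions\<close>

lemma adjoint_mult_self_diag:
  assumes "T \<in> carrier_mat m m" "i < m"
  shows "(mat_adjoint T * T) $$ (i, i) = complex_of_real (\<Sum>k<m. (cmod (T $$ (k, i)))\<^sup>2)"
proof -
  have "(mat_adjoint T * T) $$ (i, i) = (\<Sum>k<m. cnj (T $$ (k, i)) * T $$ (k, i))"
    using assms by (simp add: scalar_prod_def lessThan_atLeast0)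
  then show ?thesis by (simp add: complex_norm_square mult.commute del: of_real_power)
qed

text \<open>If \<open>W\<close> diagonalises the Gram matrix of \<open>K\<close>, the columns of
  \<open>T = K W\<close> are orthogonal with squared lengths \<open>f i\<close>. Invertibility makes
  these lengths positive, so dividing by them yields the unitary factor on the left.\<close>

theorem svd_invertible:
  assumes K: "K \<in> carrier_mat m m" and L: "L \<in> carrier_mat m m" and LK: "L * K = 1\<^sub>m m"
  shows "\<exists>U V \<gamma>. unitary_mat m U \<and> unitary_mat m V \<and> (\<forall>i<m. \<gamma> i > 0) \<and>
    K = U * mat_diag m (\<lambda>i. complex_of_real (\<gamma> i)) * V"
proof -
  note sq = assoc_mult_mat[of _ m m _ m _ m] mult_carrier_mat[of _ m m _ m] mat_adjoint_mult[of _ m m _ m]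
  have KL: "K * L = 1\<^sub>m m" using mat_mult_left_right_inverse[OF L K LK] .
  have G: "mat_adjoint K * K \<in> carrier_mat m m" "mat_adjoint (mat_adjoint K * K) = mat_adjoint K * K"
    using K by (auto simp: sq)
  obtain W f where W: "unitary_mat m W"
    and GW: "mat_adjoint K * K = W * mat_diag m (\<lambda>i. complex_of_real (f i)) * mat_adjoint W"
    using hermitian_diagonalization[OF G] by blast
  note Wc = unitary_matD[OF W]
  let ?D = "mat_diag m (\<lambda>i. complex_of_real (f i))"
  define T where "T = K * W"
  define R where "R = mat_adjoint W * L"
  have T: "T \<in> carrier_mat m m" and R: "R \<in> carrier_mat m m"
    using K L Wc by (auto simp: T_def R_def intro!: mult_carrier_mat[of _ m m _ m])
  have "T * R = K * (W * (mat_adjoint W * L))" using K L Wc by (simp add: T_def R_def sq)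
  then have TR: "T * R = 1\<^sub>m m"
    using K L Wc KL by (simp add: mult_cancel_left_inverse[of W "mat_adjoint W" m L m])
  have "mat_adjoint T * T = mat_adjoint W * (mat_adjoint K * K) * W"
    using K Wc by (simp add: T_def sq)
  also have "\<dots> = ?D" unfolding GW using unitary_conj_cancel[OF W mat_diag_dim] .
  finally have TT: "mat_adjoint T * T = ?D" .
  have f: "f i = (\<Sum>k<m. (cmod (T $$ (k, i)))\<^sup>2)" if "i < m" for i
    using adjoint_mult_self_diag[OF T that] unfolding TT using that
    by (metis mat_diag_index of_real_eq_iff)
  have fpos: "f i > 0" if "i < m" for i
  proof -
    \<comment> \<open>\<open>R\<close> is the inverse of \<open>T\<close>, hence
      \<open>R * mat_adjoint R\<close> is the inverse of the Gram matrix \<open>?D\<close>; a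
      vanishing \<open>f i\<close> would give this product a zero row.\<close>
    have "?D * (R * mat_adjoint R) = mat_adjoint T * (T * R) * mat_adjoint R"
      unfolding TT[symmetric] using T R by (simp add: sq)
    also have "\<dots> = mat_adjoint (R * T)" using T R by (simp add: TR mat_adjoint_mult[of _ m m _ m])
    also have "R * T = 1\<^sub>m m" using mat_mult_left_right_inverse[OF T R TR] .
    finally have "(?D * (R * mat_adjoint R)) $$ (i, i) = 1" using that by simp
    moreover have "(?D * (R * mat_adjoint R)) $$ (i, i) = complex_of_real (f i) * (R * mat_adjoint R) $$ (i, i)"
      using R that by (subst mat_diag_mult_left[of _ m m]) (auto simp: sq)
    ultimately have "f i \<noteq> 0" by auto
    then show ?thesis using f[OF that] by (simp add: less_le sum_nonneg)
  qed
  define \<gamma> where "\<gamma> i = sqrt (f i)" for i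
  have \<gamma>: "\<gamma> i > 0" if "i < m" for i using fpos[OF that] by (simp add: \<gamma>_def)
  let ?I = "mat_diag m (\<lambda>i. complex_of_real (1 / \<gamma> i))"
  let ?\<Gamma> = "mat_diag m (\<lambda>i. complex_of_real (\<gamma> i))"
  have I: "mat_adjoint ?I = ?I" by simp
  have U: "unitary_mat m (T * ?I)"
  proof (rule unitary_matI)
    show "T * ?I \<in> carrier_mat m m" using T by (auto intro!: mult_carrier_mat[of _ m m _ m])
    have "mat_adjoint (T * ?I) * (T * ?I) = ?I * (mat_adjoint T * T) * ?I"
      using T by (simp add: sq del: mat_diag_diag)
    also have "\<dots> = mat_diag m (\<lambda>i. complex_of_real (1 / \<gamma> i * f i * (1 / \<gamma> i)))"
      unfolding TT by simp
    also have "\<dots> = mat_diag m (\<lambda>_. 1)"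
    proof (rule mat_diag_cong)
      fix i assume "i < m"
      then have "\<gamma> i * \<gamma> i = f i" "f i > 0" using fpos by (auto simp: \<gamma>_def less_imp_le)
      then have "1 / \<gamma> i * f i * (1 / \<gamma> i) = 1" by (auto simp: field_simps)
      then show "complex_of_real (1 / \<gamma> i * f i * (1 / \<gamma> i)) = 1" by (simp only: of_real_1)
    qed
    finally show "mat_adjoint (T * ?I) * (T * ?I) = 1\<^sub>m m" by simp
  qed
  have "?I * ?\<Gamma> = mat_diag m (\<lambda>_. 1)"
    unfolding mat_diag_diag using \<gamma> by (intro mat_diag_cong) (auto simp: less_imp_neq[symmetric])
  then have I\<Gamma>: "?I * ?\<Gamma> = 1\<^sub>m m" by simp
  have "T * ?I * ?\<Gamma> * mat_adjoint W = T * (?I * ?\<Gamma>) * mat_adjoint W"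
    using T Wc by (simp add: sq del: mat_diag_diag)
  also have "\<dots> = K * (W * mat_adjoint W)" unfolding I\<Gamma> using T K Wc(1) by (simp add: T_def sq)
  also have "\<dots> = K" using K Wc by simp
  finally have "K = T * ?I * ?\<Gamma> * mat_adjoint W" ..
  then show ?thesis using U unitary_mat_adjoint[OF W] \<gamma> by blast
qed

text \<open>The bound is tested at the right singular vector
  \<open>mat_adjoint V *\<^sub>v unit_vec m i\<close>, which is mapped to \<open>\<gamma> i\<close>
  times a vector of length one.\<close>

lemma singular_value_le:
  assumes U: "unitary_mat m U" and V: "unitary_mat m V" and c: "c \<ge> 0"
    and bound: "\<And>v. v \<in> carrier_vec m \<Longrightarrow>
      Re ((U * mat_diag m (\<lambda>i. complex_of_real (\<gamma> i)) * V *\<^sub>v v)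
        \<bullet>c (U * mat_diag m (\<lambda>i. complex_of_real (\<gamma> i)) * V *\<^sub>v v)) \<le> c\<^sup>2 * Re (v \<bullet>c v)"
    and i: "i < m" and pos: "\<gamma> i \<ge> 0"
  shows "\<gamma> i \<le> c"
proof -
  note Uc = unitary_matD[OF U] and Vc = unitary_matD[OF V]
  let ?D = "mat_diag m (\<lambda>i. complex_of_real (\<gamma> i))"
  define v where "v = mat_adjoint V *\<^sub>v unit_vec m i"
  have v: "v \<in> carrier_vec m" using Vc by (auto simp: v_def)
  have Vv: "V *\<^sub>v v = unit_vec m i"
    using Vc by (simp add: v_def assoc_mult_mat_vec[symmetric, of _ m m _ m] del: assoc_mult_mat_vec)
  have nv: "Re (v \<bullet>c v) = 1"
  proof -
    have "Re (v \<bullet>c v) = (\<Sum>j<m. (cmod ((unit_vec m i :: complex vec) $ j))\<^sup>2)"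
      using norm_unitary[OF unitary_mat_adjoint[OF V] v] by (simp add: Vv del: index_mult_mat_vec)
    also have "\<dots> = (\<Sum>j<m. if j = i then 1 else 0)" using i by (intro sum.cong) auto
    finally show ?thesis using i by simp
  qed
  let ?w = "U * ?D * V *\<^sub>v v"
  have De: "?D *\<^sub>v unit_vec m i \<in> carrier_vec m" by (rule mult_mat_vec_carrier[of _ m m]) auto
  have UD: "U * ?D \<in> carrier_mat m m" using Uc by (auto intro!: mult_carrier_mat[of _ m m _ m])
  have w: "?w = U *\<^sub>v (?D *\<^sub>v unit_vec m i)"
    unfolding assoc_mult_mat_vec[OF UD Vc(1) v] Vv
    using Uc by (intro assoc_mult_mat_vec[of _ m m _ m]) auto
  have wc: "?w \<in> carrier_vec m" unfolding w using Uc De by (intro mult_mat_vec_carrier[of _ m m]) auto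
  have "mat_adjoint U *\<^sub>v ?w = (mat_adjoint U * U) *\<^sub>v (?D *\<^sub>v unit_vec m i)"
    unfolding w using Uc(1) De by (intro assoc_mult_mat_vec[symmetric, of _ m m _ m]) auto
  then have Uw: "mat_adjoint U *\<^sub>v ?w = ?D *\<^sub>v unit_vec m i" using Uc De by simp
  have "Re (?w \<bullet>c ?w) = (\<Sum>j<m. (cmod ((?D *\<^sub>v unit_vec m i) $ j))\<^sup>2)"
    unfolding norm_unitary[OF U wc] Uw ..
  also have "\<dots> = (\<Sum>j<m. if j = i then (\<gamma> i)\<^sup>2 else 0)"
    using i by (intro sum.cong refl) (auto simp: mat_diag_mult_vec norm_mult simp del: index_mult_mat_vec)
  also have "\<dots> = (\<gamma> i)\<^sup>2" using i by simp
  finally have "(\<gamma> i)\<^sup>2 \<le> c\<^sup>2" using bound[OF v] nv by simp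
  then show ?thesis using c by (rule power2_le_imp_le)
qed

text \<open>A diagonal matrix with entries in \<open>[0, 1]\<close> is the mean of the unitary matrices
  with diagonal entries \<open>exp (\<plusminus> i \<theta>)\<close>, where \<open>cos \<theta>\<close> is the given entry.\<close>

lemma diag_eq_mean_of_unitaries:
  assumes \<gamma>: "\<And>i. i < m \<Longrightarrow> 0 \<le> \<gamma> i" "\<And>i. i < m \<Longrightarrow> \<gamma> i \<le> c"
  shows "\<exists>E F. unitary_mat m E \<and> unitary_mat m F \<and>
    mat_diag m (\<lambda>i. complex_of_real (\<gamma> i)) = complex_of_real (c / 2) \<cdot>\<^sub>m (E + F)"
proof -
  define \<theta> where "\<theta> i = arccos (\<gamma> i / c)" for i
  have "complex_of_real (\<gamma> i) = complex_of_real (c / 2) * (cis (\<theta> i) + cis (- \<theta> i))" if "i < m" for i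
  proof (cases "c = 0")
    case True
    then show ?thesis using \<gamma>[OF that] by simp
  next
    case False
    then have "cos (\<theta> i) = \<gamma> i / c"
      unfolding \<theta>_def using \<gamma>[OF that] by (intro cos_arccos) (auto simp: field_simps)
    then show ?thesis using False by (auto simp: complex_eq_iff)
  qed
  then have "mat_diag m (\<lambda>i. complex_of_real (\<gamma> i))
      = complex_of_real (c / 2) \<cdot>\<^sub>m (mat_diag m (\<lambda>i. cis (\<theta> i)) + mat_diag m (\<lambda>i. cis (- \<theta> i)))"
    by (intro eq_matI) auto
  moreover have "unitary_mat m (mat_diag m (\<lambda>i. cis (\<theta> i)))" "unitary_mat m (mat_diag m (\<lambda>i. cis (- \<theta> i)))"
    by (auto intro!: unitary_mat_diag)
  ultimately show ?thesis by blast
qed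

text \<open>The diagonal factor is \<open>c\<close> times an average of two unitary factors, each of
  which preserves the norm.\<close>

lemma uin_diag_le:
  assumes N: "unitarily_invariant_norm m N" and Z: "Z \<in> carrier_mat m m" and c: "c \<ge> 0"
    and \<gamma>: "\<And>i. i < m \<Longrightarrow> 0 \<le> \<gamma> i" "\<And>i. i < m \<Longrightarrow> \<gamma> i \<le> c"
  shows "N (mat_diag m (\<lambda>i. complex_of_real (\<gamma> i)) * Z) \<le> c * N Z"
    and "N (Z * mat_diag m (\<lambda>i. complex_of_real (\<gamma> i))) \<le> c * N Z"
proof -
  obtain E F where E: "unitary_mat m E" and F: "unitary_mat m F"
    and EF: "mat_diag m (\<lambda>i. complex_of_real (\<gamma> i)) = complex_of_real (c / 2) \<cdot>\<^sub>m (E + F)"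
    using diag_eq_mean_of_unitaries[of m \<gamma> c] \<gamma> by blast
  note Ec = unitary_matD(1)[OF E] and Fc = unitary_matD(1)[OF F]
  have EFc: "E + F \<in> carrier_mat m m" using Ec Fc by auto
  have prods: "E * Z \<in> carrier_mat m m" "F * Z \<in> carrier_mat m m"
    "Z * E \<in> carrier_mat m m" "Z * F \<in> carrier_mat m m"
    using Ec Fc Z by (auto intro!: mult_carrier_mat[of _ m m _ m])
  have "N (complex_of_real (c / 2) \<cdot>\<^sub>m (E + F) * Z) = N (complex_of_real (c / 2) \<cdot>\<^sub>m (E * Z + F * Z))"
    unfolding mult_smult_assoc_mat[OF EFc Z] add_mult_distrib_mat[OF Ec Fc Z] ..
  also have "\<dots> = c / 2 * N (E * Z + F * Z)"
    using uin_smult[OF N add_carrier_mat[OF prods(2)]] c by simp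
  also have "\<dots> \<le> c / 2 * (N (E * Z) + N (F * Z))"
    using uin_add[OF N prods(1,2)] c by (intro mult_left_mono) auto
  finally show "N (mat_diag m (\<lambda>i. complex_of_real (\<gamma> i)) * Z) \<le> c * N Z"
    by (simp add: EF uin_unitary_left[OF N Z] E F)
  have "N (Z * (complex_of_real (c / 2) \<cdot>\<^sub>m (E + F))) = N (complex_of_real (c / 2) \<cdot>\<^sub>m (Z * E + Z * F))"
    unfolding mult_smult_distrib[OF Z EFc] mult_add_distrib_mat[OF Z Ec Fc] ..
  also have "\<dots> = c / 2 * N (Z * E + Z * F)"
    using uin_smult[OF N add_carrier_mat[OF prods(4)]] c by simp
  also have "\<dots> \<le> c / 2 * (N (Z * E) + N (Z * F))"
    using uin_add[OF N prods(3,4)] c by (intro mult_left_mono) auto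
  finally show "N (Z * mat_diag m (\<lambda>i. complex_of_real (\<gamma> i))) \<le> c * N Z"
    by (simp add: EF uin_unitary_right[OF N Z] E F)
qed

text \<open>The hypothesis \<open>bound\<close> says that \<open>c\<close> is at least the operator
  norm of \<open>K\<close>, and a singular value decomposition reduces the claim to diagonal
  factors. The left factor is the adjoint because the application has \<open>S^T\<close> on the
  left, while the bound is known for \<open>S\<close>.\<close>

lemma uin_bounded_mult_le:
  assumes N: "unitarily_invariant_norm m N" and K: "K \<in> carrier_mat m m" and L: "L \<in> carrier_mat m m"
    and LK: "L * K = 1\<^sub>m m" and c: "c \<ge> 0"
    and bound: "\<And>v. v \<in> carrier_vec m \<Longrightarrow> Re ((K *\<^sub>v v) \<bullet>c (K *\<^sub>v v)) \<le> c\<^sup>2 * Re (v \<bullet>c v)"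
    and Z: "Z \<in> carrier_mat m m"
  shows "N (mat_adjoint K * Z) \<le> c * N Z" "N (Z * K) \<le> c * N Z"
proof -
  note sq = assoc_mult_mat[of _ m m _ m _ m] mult_carrier_mat[of _ m m _ m] mat_adjoint_mult[of _ m m _ m]
  obtain U V \<gamma> where U: "unitary_mat m U" and V: "unitary_mat m V" and pos: "\<forall>i<m. \<gamma> i > 0"
    and KU: "K = U * mat_diag m (\<lambda>i. complex_of_real (\<gamma> i)) * V"
    using svd_invertible[OF K L LK] by blast
  note Uc = unitary_matD(1)[OF U] and Vc = unitary_matD(1)[OF V]
  let ?D = "mat_diag m (\<lambda>i. complex_of_real (\<gamma> i))"
  have ge: "0 \<le> \<gamma> i" if "i < m" for i using pos that by (simp add: less_imp_le)
  have le: "\<gamma> i \<le> c" if "i < m" for i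
    by (rule singular_value_le[OF U V c bound[unfolded KU] that ge[OF that]])
  have UZ: "mat_adjoint U * Z \<in> carrier_mat m m" "?D * (mat_adjoint U * Z) \<in> carrier_mat m m"
    "Z * U \<in> carrier_mat m m" "Z * U * ?D \<in> carrier_mat m m"
    using Uc Z by (auto simp: sq)
  have "N (mat_adjoint K * Z) = N (mat_adjoint V * (?D * (mat_adjoint U * Z)))"
    unfolding KU using Uc Vc Z by (simp add: sq)
  also have "\<dots> = N (?D * (mat_adjoint U * Z))"
    using UZ by (intro uin_unitary_left[OF N] unitary_mat_adjoint V)
  also have "\<dots> \<le> c * N (mat_adjoint U * Z)" by (rule uin_diag_le[OF N UZ(1) c ge le])
  finally show "N (mat_adjoint K * Z) \<le> c * N Z"
    by (simp add: uin_unitary_left[OF N Z unitary_mat_adjoint[OF U]])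
  have "N (Z * K) = N (Z * U * ?D * V)"
    unfolding KU using Uc Vc Z by (simp add: sq)
  also have "\<dots> = N (Z * U * ?D)" using UZ by (intro uin_unitary_right[OF N] V)
  also have "\<dots> \<le> c * N (Z * U)" by (rule uin_diag_le[OF N UZ(3) c ge le])
  finally show "N (Z * K) \<le> c * N Z" by (simp add: uin_unitary_right[OF N Z U])
qed

section \<open>Invariance under the adjoint\<close>

lemma ex_inverse_mat:
  fixes A :: "'a :: field mat"
  assumes "A \<in> carrier_mat m m" "det A \<noteq> 0"
  shows "\<exists>B. B \<in> carrier_mat m m \<and> B * A = 1\<^sub>m m"
  using det_non_zero_imp_unit[OF assms, of "()"] unfolding Units_def ring_mat_def by auto

text \<open>The shifted matrix is singular only if \<open>- \<delta>\<close> is one of the finitely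
  many eigenvalues of \<open>T\<close>, and the interval from \<open>0\<close> to
  \<open>\<epsilon>\<close> has infinitely many points.\<close>

lemma ex_invertible_perturbation:
  fixes T :: "complex mat"
  assumes T: "T \<in> carrier_mat m m" and \<epsilon>: "\<epsilon> > 0"
  shows "\<exists>\<delta> L. 0 < \<delta> \<and> \<delta> < \<epsilon> \<and> L \<in> carrier_mat m m \<and> L * (T + complex_of_real \<delta> \<cdot>\<^sub>m 1\<^sub>m m) = 1\<^sub>m m"
proof -
  have "finite ((\<lambda>x. complex_of_real (- x)) -` spectrum T)"
    using card_finite_spectrum(1)[OF T] by (intro finite_vimageI) (auto simp: inj_def)
  then have "infinite ({0<..<\<epsilon>} - (\<lambda>x. complex_of_real (- x)) -` spectrum T)"
    using \<epsilon> by (intro Diff_infinite_finite) (auto simp: infinite_Ioo)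
  then obtain \<delta> where \<delta>: "\<delta> \<in> {0<..<\<epsilon>} - (\<lambda>x. complex_of_real (- x)) -` spectrum T"
    by (metis ex_in_conv finite.emptyI)
  then have "\<not> eigenvalue T (complex_of_real (- \<delta>))" by (auto simp: spectrum_def)
  then have "det (T + complex_of_real \<delta> \<cdot>\<^sub>m 1\<^sub>m m) \<noteq> 0"
    using T by (simp add: eigenvalue_det[OF T] char_matrix_def)
  then show ?thesis using ex_inverse_mat[of "T + complex_of_real \<delta> \<cdot>\<^sub>m 1\<^sub>m m" m] T \<delta> by auto
qed

text \<open>The adjoint has the same singular values: the real diagonal factor stays, the unitary
  factors change sides.\<close>

lemma uin_adjoint_invertible:
  assumes N: "unitarily_invariant_norm m N"
    and K: "K \<in> carrier_mat m m" and L: "L \<in> carrier_mat m m" and LK: "L * K = 1\<^sub>m m"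
  shows "N (mat_adjoint K) = N K"
proof -
  obtain U V \<gamma> where U: "unitary_mat m U" and V: "unitary_mat m V"
    and KU: "K = U * mat_diag m (\<lambda>i. complex_of_real (\<gamma> i)) * V"
    using svd_invertible[OF K L LK] by blast
  note Uc = unitary_matD(1)[OF U] and Vc = unitary_matD(1)[OF V]
  let ?D = "mat_diag m (\<lambda>i. complex_of_real (\<gamma> i))"
  have "mat_adjoint K = mat_adjoint V * ?D * mat_adjoint U"
    unfolding KU using Uc Vc
    by (simp add: assoc_mult_mat[of _ m m _ m _ m] mult_carrier_mat[of _ m m _ m] mat_adjoint_mult[of _ m m _ m])
  then show ?thesis
    using uin_unitary[OF N mat_diag_dim unitary_mat_adjoint[OF V] unitary_mat_adjoint[OF U]]
      uin_unitary[OF N mat_diag_dim U V] by (simp add: KU)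
qed

text \<open>The singular value decomposition above is for invertible matrices, so the general case
  is reached by adding a small multiple of the identity.\<close>

theorem uin_adjoint:
  assumes N: "unitarily_invariant_norm m N" and T: "T \<in> carrier_mat m m"
  shows "N (mat_adjoint T) = N T"
proof -
  have le: "N (mat_adjoint T) \<le> N T" if T: "T \<in> carrier_mat m m" for T
  proof (rule field_le_epsilon)
    fix e :: real assume e: "e > 0"
    define n1 where "n1 = N (1\<^sub>m m)"
    have n1: "n1 \<ge> 0" unfolding n1_def using uin_nonneg[OF N] by auto
    \<comment> \<open>The shift is paid for twice, once for the adjoint and once for
      \<open>T\<close> itself, each time with \<open>\<delta> * n1\<close>; this choice keeps the
      total below \<open>e\<close>.\<close>
    define \<epsilon> where "\<epsilon> = e / (2 * (n1 + 1))"
    have \<epsilon>: "\<epsilon> > 0" using e n1 by (auto simp: \<epsilon>_def)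
    obtain \<delta> L where \<delta>: "0 < \<delta>" "\<delta> < \<epsilon>" and L: "L \<in> carrier_mat m m"
      and LT: "L * (T + complex_of_real \<delta> \<cdot>\<^sub>m 1\<^sub>m m) = 1\<^sub>m m"
      using ex_invertible_perturbation[OF T \<epsilon>] by blast
    let ?T = "T + complex_of_real \<delta> \<cdot>\<^sub>m 1\<^sub>m m"
    have Tc: "?T \<in> carrier_mat m m" using T by auto
    have "mat_adjoint T = mat_adjoint ?T + complex_of_real (- \<delta>) \<cdot>\<^sub>m 1\<^sub>m m"
      using T by (intro eq_matI) auto
    then have "N (mat_adjoint T) \<le> N (mat_adjoint ?T) + N (complex_of_real (- \<delta>) \<cdot>\<^sub>m 1\<^sub>m m)"
      using uin_add[OF N, of "mat_adjoint ?T" "complex_of_real (- \<delta>) \<cdot>\<^sub>m 1\<^sub>m m"] Tc by auto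
    also have "\<dots> = N ?T + \<delta> * n1"
      unfolding uin_smult[OF N one_carrier_mat] norm_of_real n1_def
      using uin_adjoint_invertible[OF N Tc L LT] \<delta> by simp
    also have "N ?T \<le> N T + \<delta> * n1"
      using uin_add[OF N T, of "complex_of_real \<delta> \<cdot>\<^sub>m 1\<^sub>m m"] \<delta>
      unfolding uin_smult[OF N one_carrier_mat] norm_of_real n1_def by simp
    also have "N T + \<delta> * n1 + \<delta> * n1 \<le> N T + 2 * (\<epsilon> * (n1 + 1))"
      using mult_mono[of \<delta> \<epsilon> n1 "n1 + 1"] \<delta> n1 by simp
    also have "\<dots> = N T + e" using n1 by (simp add: \<epsilon>_def field_simps)
    finally show "N (mat_adjoint T) \<le> N T + e" by simp
  qed
  show ?thesis using le[OF T] le[of "mat_adjoint T"] T by simp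
qed

section \<open>A lower bound for generalised commutators\<close>

text \<open>With \<open>K = 1 + \<epsilon> G\<close>, the product \<open>K C K\<close> is \<open>C + \<epsilon> (G C + C G)\<close> up to second order, while
  \<open>C\<close> is recovered from it by the contractive factors \<open>K\<inverse>\<close>.\<close>

lemma uin_anticommutator_ge:
  assumes N: "unitarily_invariant_norm m N" and C: "C \<in> carrier_mat m m"
    and g: "\<And>i. i < m \<Longrightarrow> \<gamma> \<le> g i" and \<gamma>: "\<gamma> \<ge> 0"
  defines "G \<equiv> mat_diag m (\<lambda>i. complex_of_real (g i))"
  shows "2 * \<gamma> * N C \<le> N (G * C + C * G)"
proof (rule field_le_epsilon)
  fix e :: real assume e: "e > 0"
  have G: "G \<in> carrier_mat m m" by (simp add: G_def)
  have GC: "G * C \<in> carrier_mat m m" "C * G \<in> carrier_mat m m" "G * C * G \<in> carrier_mat m m"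
    using G C by (auto simp: mult_carrier_mat[of _ m m _ m])
  define Z where "Z = G * C + C * G"
  have Z: "Z \<in> carrier_mat m m" using GC by (auto simp: Z_def)
  define R where "R = N (G * C * G)"
  have R: "R \<ge> 0" unfolding R_def using uin_nonneg[OF N GC(3)] .
  \<comment> \<open>After division by \<open>\<epsilon>\<close> the second order term contributes
    \<open>\<epsilon> * R\<close>, which must not exceed \<open>e\<close>; the added one covers
    \<open>R = 0\<close>.\<close>
  define \<epsilon> where "\<epsilon> = e / (R + 1)"
  have \<epsilon>: "\<epsilon> > 0" "\<epsilon> * R \<le> e" using e R by (auto simp: \<epsilon>_def field_simps)
  define h where "h i = 1 + \<epsilon> * g i" for i
  define c where "c = 1 + \<epsilon> * \<gamma>"
  have h: "c \<le> h i" if "i < m" for i using g[OF that] \<epsilon> by (auto simp: h_def c_def)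
  have c: "c \<ge> 1" using \<epsilon> \<gamma> by (auto simp: c_def)
  let ?K = "mat_diag m (\<lambda>i. complex_of_real (h i))"
  let ?I = "mat_diag m (\<lambda>i. complex_of_real (1 / h i))"
  have hpos: "h i > 0" if "i < m" for i using h[OF that] c by simp
  have "?I * ?K = mat_diag m (\<lambda>_. 1)" "?K * ?I = mat_diag m (\<lambda>_. 1)"
    unfolding mat_diag_diag using hpos by (auto intro!: mat_diag_cong simp: less_imp_neq[symmetric])
  then have IK: "?I * ?K = 1\<^sub>m m" "?K * ?I = 1\<^sub>m m" by simp_all
  have le: "0 \<le> 1 / h i" "1 / h i \<le> 1 / c" if "i < m" for i
    using h[OF that] c by (auto intro!: divide_left_mono)
  have KCK: "?K * C * ?K = C + complex_of_real \<epsilon> \<cdot>\<^sub>m Z + complex_of_real (\<epsilon>\<^sup>2) \<cdot>\<^sub>m (G * C * G)"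
    unfolding Z_def G_def
    using C by (subst mat_diag_mult_left[of _ m m] mat_diag_mult_right[of _ m m],
        auto simp: mat_diag_mult_left[of _ m m] mat_diag_mult_right[of _ m m] h_def
        algebra_simps power2_eq_square intro!: eq_matI)
  have KC: "?K * C \<in> carrier_mat m m" "?K * C * ?K \<in> carrier_mat m m" "?K * C * ?K * ?I \<in> carrier_mat m m"
    using C by (auto simp: mult_carrier_mat[of _ m m _ m])
  have "?K * C * ?K * ?I = ?K * C * (?K * ?I)" using KC by (intro assoc_mult_mat[of _ m m _ m _ m]) auto
  then have "?I * (?K * C * ?K * ?I) = ?I * (?K * C)" unfolding IK
    by (simp only: right_mult_one_mat[OF KC(1)])
  also have "\<dots> = C" using C IK by (intro mult_cancel_left_inverse[of _ _ m]) auto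
  finally have "N C = N (?I * (?K * C * ?K * ?I))" by simp
  also have "\<dots> \<le> 1 / c * N (?K * C * ?K * ?I)"
    using c by (intro uin_diag_le(1)[OF N KC(3)] le) auto
  also have "\<dots> \<le> 1 / c * (1 / c * N (?K * C * ?K))"
    using c by (intro mult_left_mono uin_diag_le(2)[OF N KC(2)] le) auto
  finally have 1: "c\<^sup>2 * N C \<le> N (?K * C * ?K)" using c by (simp add: field_simps power2_eq_square)
  have cZ: "C + complex_of_real \<epsilon> \<cdot>\<^sub>m Z \<in> carrier_mat m m" using Z by auto
  have "N (?K * C * ?K) \<le> N (C + complex_of_real \<epsilon> \<cdot>\<^sub>m Z) + N (complex_of_real (\<epsilon>\<^sup>2) \<cdot>\<^sub>m (G * C * G))"
    unfolding KCK using cZ GC by (intro uin_add[OF N]) auto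
  also have "N (C + complex_of_real \<epsilon> \<cdot>\<^sub>m Z) \<le> N C + N (complex_of_real \<epsilon> \<cdot>\<^sub>m Z)"
    using C Z by (intro uin_add[OF N]) auto
  finally have 2: "N (?K * C * ?K) \<le> N C + \<epsilon> * N Z + \<epsilon>\<^sup>2 * R"
    unfolding uin_smult[OF N Z] uin_smult[OF N GC(3)] norm_of_real R_def using \<epsilon> by simp
  \<comment> \<open>In the comparison of the two estimates \<open>N C\<close> cancels and the square
    of \<open>\<epsilon> * \<gamma>\<close> is dropped as non-negative, which leaves the first order
    terms and the remainder.\<close>
  have "c\<^sup>2 * N C = N C + \<epsilon> * (2 * \<gamma> * N C) + (\<epsilon> * \<gamma>)\<^sup>2 * N C"
    by (simp add: c_def power2_eq_square algebra_simps)
  then have "\<epsilon> * (2 * \<gamma> * N C) \<le> \<epsilon> * (N Z + \<epsilon> * R)"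
    using 1 2 uin_nonneg[OF N C] by (simp add: power2_eq_square algebra_simps)
      (smt (verit) mult_nonneg_nonneg zero_le_mult_iff zero_le_square mult.assoc)
  then have "2 * \<gamma> * N C \<le> N Z + \<epsilon> * R" using \<epsilon>(1) by simp
  then show "2 * \<gamma> * N C \<le> N (G * C + C * G) + e" using \<epsilon>(2) by (simp add: Z_def)
qed

text \<open>With \<open>Z = A G - G B\<close> and \<open>C = A - B\<close>, hermiticity gives
  \<open>Z + mat_adjoint Z = G C + C G\<close>. Invariance under the adjoint bounds the norm of this
  sum by twice that of \<open>Z\<close>.\<close>

lemma uin_generalized_commutator_ge:
  assumes N: "unitarily_invariant_norm m N"
    and A: "A \<in> carrier_mat m m" "mat_adjoint A = A" and B: "B \<in> carrier_mat m m" "mat_adjoint B = B"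
    and g: "\<And>i. i < m \<Longrightarrow> \<gamma> \<le> g i" and \<gamma>: "\<gamma> \<ge> 0"
  defines "G \<equiv> mat_diag m (\<lambda>i. complex_of_real (g i))"
  shows "\<gamma> * N (A - B) \<le> N (A * G - G * B)"
proof -
  have G: "G \<in> carrier_mat m m" "mat_adjoint G = G" by (simp_all add: G_def)
  define Z where "Z = A * G - G * B"
  have prods: "A * G \<in> carrier_mat m m" "G * B \<in> carrier_mat m m" "G * A \<in> carrier_mat m m" "B * G \<in> carrier_mat m m"
    using A B G by (auto simp: mult_carrier_mat[of _ m m _ m])
  have Z: "Z \<in> carrier_mat m m" using prods by (auto simp: Z_def intro!: minus_carrier_mat)
  have AB: "A - B \<in> carrier_mat m m" using B by (auto intro!: minus_carrier_mat)
  have "mat_adjoint Z = G * A - B * G"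
    using A B G prods by (simp add: Z_def mat_adjoint_minus[of _ m m] mat_adjoint_mult[of _ m m _ m])
  then have "Z + mat_adjoint Z = (A * G - G * B) + (G * A - B * G)" by (simp add: Z_def)
  also have "\<dots> = (G * A - G * B) + (A * G - B * G)"
    using A B G by (intro eq_matI) (auto simp del: index_mult_mat(1))
  also have "\<dots> = G * (A - B) + (A - B) * G"
    using A B G by (simp add: mult_minus_distrib_mat[of _ m m _ m] minus_mult_distrib_mat[of _ m m _ _ m])
  finally have "N (G * (A - B) + (A - B) * G) = N (Z + mat_adjoint Z)" by simp
  also have "\<dots> \<le> N Z + N (mat_adjoint Z)" using Z by (intro uin_add[OF N]) auto
  also have "\<dots> = 2 * N Z" using uin_adjoint[OF N Z] by simp
  finally have "N (G * (A - B) + (A - B) * G) \<le> 2 * N Z" .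
  moreover have "2 * \<gamma> * N (A - B) \<le> N (G * (A - B) + (A - B) * G)"
    unfolding G_def by (rule uin_anticommutator_ge[OF N AB g \<gamma>])
  ultimately show ?thesis by (simp add: Z_def)
qed

text \<open>In the singular bases of \<open>X\<close> the two expressions become
  \<open>A F - F B\<close>, with \<open>F\<close> the diagonal of the singular values for
  \<open>X\<close> and of their reciprocals for \<open>Y\<close>. The lower bound \<open>2\<close>
  for \<open>\<gamma> i + 1 / \<gamma> i\<close> exactly pays for adding two terms, so that no
  constant depending on \<open>X\<close> remains.\<close>

theorem uin_sylvester_ge:
  assumes N: "unitarily_invariant_norm m N"
    and H: "H \<in> carrier_mat m m" "mat_adjoint H = H" and H': "H' \<in> carrier_mat m m" "mat_adjoint H' = H'"
    and X: "X \<in> carrier_mat m m" and Y: "Y \<in> carrier_mat m m" and XY: "mat_adjoint X * Y = 1\<^sub>m m"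
    and le: "N (H * Y - Y * H') \<le> N (H * X - X * H')"
  shows "\<exists>U V. unitary_mat m U \<and> unitary_mat m V \<and>
    N (U * H * mat_adjoint U - V * H' * mat_adjoint V) \<le> N (H * X - X * H')"
proof -
  note sq = assoc_mult_mat[of _ m m _ m _ m] mult_carrier_mat[of _ m m _ m] mat_adjoint_mult[of _ m m _ m]
  have "mat_adjoint Y * X = 1\<^sub>m m"
    using arg_cong[OF XY, of mat_adjoint] X Y by (simp add: sq)
  then obtain U V \<gamma> where U: "unitary_mat m U" and V: "unitary_mat m V" and pos: "\<forall>i<m. \<gamma> i > 0"
    and XU: "X = U * mat_diag m (\<lambda>i. complex_of_real (\<gamma> i)) * V"
    using svd_invertible[OF X, of "mat_adjoint Y"] Y by auto
  note Uc = unitary_matD[OF U] and Vc = unitary_matD[OF V]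
  let ?D = "mat_diag m (\<lambda>i. complex_of_real (\<gamma> i))"
  let ?E = "mat_diag m (\<lambda>i. complex_of_real (1 / \<gamma> i))"
  let ?W = "U * ?E * V"
  have W: "?W \<in> carrier_mat m m" using Uc Vc by (simp add: sq)
  have "?D * ?E = mat_diag m (\<lambda>_. 1)"
    unfolding mat_diag_diag using pos by (auto intro!: mat_diag_cong simp: less_imp_neq[symmetric])
  then have DE: "?D * ?E = 1\<^sub>m m" by simp
  have "mat_adjoint X * ?W = mat_adjoint V * (?D * (mat_adjoint U * (U * (?E * V))))"
    unfolding XU using Uc(1) Vc(1) by (simp add: sq del: mat_diag_diag)
  also have "mat_adjoint U * (U * (?E * V)) = ?E * V"
    using Uc Vc by (intro mult_cancel_left_inverse[of _ _ m _ m]) (auto simp: sq)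
  also have "?D * (?E * V) = V"
    using DE Vc(1) by (intro mult_cancel_left_inverse[of _ _ m _ m]) auto
  finally have XW: "mat_adjoint X * ?W = 1\<^sub>m m" using Vc by simp
  \<comment> \<open>\<open>mat_adjoint X * W = 1\<close> has only one solution, so \<open>Y\<close>
    has the singular vectors of \<open>X\<close> and the reciprocal singular values.\<close>
  have "W = Y" if "W \<in> carrier_mat m m" "mat_adjoint X * W = 1\<^sub>m m" for W
  proof -
    have XX: "Y * mat_adjoint X = 1\<^sub>m m"
      using mat_mult_left_right_inverse[OF _ Y XY] X by simp
    have "W = Y * (mat_adjoint X * W)"
      using mult_cancel_left_inverse[OF XX Y _ that(1)] X by simp
    then show ?thesis using that Y by simp
  qed
  from this[OF W XW] have YU: "Y = ?W" ..
  define A where "A = mat_adjoint U * H * U"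
  define B where "B = V * H' * mat_adjoint V"
  have A: "A \<in> carrier_mat m m" "mat_adjoint A = A" and B: "B \<in> carrier_mat m m" "mat_adjoint B = B"
    using H H' Uc(1) Vc(1) by (auto simp: A_def B_def sq)
  have transform: "mat_adjoint U * (H * (U * F * V) - (U * F * V) * H') * mat_adjoint V = A * F - F * B"
    if F: "F \<in> carrier_mat m m" for F
  proof -
    have UFV: "H * (U * F * V) \<in> carrier_mat m m" "(U * F * V) * H' \<in> carrier_mat m m"
      using F H H' Uc(1) Vc(1) by (auto simp: sq)
    have c1: "mat_adjoint U * (H * (U * F * V)) \<in> carrier_mat m m"
      "mat_adjoint U * (U * F * V * H') \<in> carrier_mat m m"
      using UFV Uc(1) by (auto simp: mult_carrier_mat[of _ m m _ m])
    have "mat_adjoint U * (H * (U * F * V) - (U * F * V) * H') * mat_adjoint V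
        = mat_adjoint U * (H * (U * F * V)) * mat_adjoint V - mat_adjoint U * (U * F * V * H') * mat_adjoint V"
      using UFV c1 Uc(1) Vc(1)
      by (simp add: mult_minus_distrib_mat[of _ m m _ m] minus_mult_distrib_mat[of _ m m _ _ m])
    also have "mat_adjoint U * (H * (U * F * V)) * mat_adjoint V = A * (F * (V * mat_adjoint V))"
      using F H Uc(1) Vc(1) by (simp add: A_def sq)
    also have "\<dots> = A * F" using Vc F A by simp
    also have "mat_adjoint U * (U * F * V * H') * mat_adjoint V = mat_adjoint U * (U * (F * B))"
      using F H' Uc(1) Vc(1) by (simp add: B_def sq)
    also have "\<dots> = F * B" using Uc F B by (intro mult_cancel_left_inverse[of _ _ m _ m]) (auto simp: sq)
    finally show ?thesis .
  qed
  have transform_norm: "N (H * (U * F * V) - (U * F * V) * H') = N (A * F - F * B)"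
    if F: "F \<in> carrier_mat m m" for F
    unfolding transform[OF F, symmetric]
    using F H H' Uc(1) Vc(1)
    by (intro uin_unitary[OF N, symmetric] unitary_mat_adjoint U V minus_carrier_mat) (auto simp: sq)
  define g where "g i = \<gamma> i + 1 / \<gamma> i" for i
  let ?G = "mat_diag m (\<lambda>i. complex_of_real (g i))"
  have g: "2 \<le> g i" if "i < m" for i
  proof -
    have "\<gamma> i > 0" using pos that by simp
    moreover have "(\<gamma> i - 1)\<^sup>2 \<ge> 0" by simp
    ultimately show ?thesis by (simp add: g_def field_simps power2_eq_square)
  qed
  have G: "?G = ?D + ?E" unfolding mat_diag_add by (simp add: g_def)
  have FD: "A * F - F * B \<in> carrier_mat m m" if "F \<in> carrier_mat m m" for F
    using A B that by (intro minus_carrier_mat) (auto simp: sq)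
  have "A * (?D + ?E) - (?D + ?E) * B = (A * ?D - ?D * B) + (A * ?E - ?E * B)"
    unfolding mult_add_distrib_mat[OF A(1) mat_diag_dim mat_diag_dim] add_mult_distrib_mat[OF mat_diag_dim mat_diag_dim B(1)]
    using A B by (intro eq_matI) (auto simp del: index_mult_mat(1))
  then have "N (A * ?G - ?G * B) \<le> N (A * ?D - ?D * B) + N (A * ?E - ?E * B)"
    unfolding G using uin_add[OF N FD[OF mat_diag_dim] FD[OF mat_diag_dim]] by simp
  also have "N (A * ?D - ?D * B) = N (H * X - X * H')"
    using transform_norm[of ?D] by (simp add: XU)
  also have "N (A * ?E - ?E * B) = N (H * Y - Y * H')"
    using transform_norm[of ?E] by (simp add: YU)
  finally have "N (A * ?G - ?G * B) \<le> 2 * N (H * X - X * H')" using le by simp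
  moreover have "2 * N (A - B) \<le> N (A * ?G - ?G * B)"
    using g by (intro uin_generalized_commutator_ge[OF N A B]) auto
  ultimately have "N (A - B) \<le> N (H * X - X * H')" by simp
  then show ?thesis unfolding A_def B_def
    using U V unitary_mat_adjoint[OF U] by (intro exI[of _ "mat_adjoint U"] exI[of _ V]) auto
qed

section \<open>Symplectic matrices\<close>

lemma symplectic_form_carrier [simp]: "symplectic_form n \<in> carrier_mat (2 * n) (2 * n)"
  using four_block_carrier_mat[of "0\<^sub>m n n" n n "0\<^sub>m n n" n n]
  by (simp add: symplectic_form_def mult_2)

lemma transpose_symplectic_form: "transpose_mat (symplectic_form n) = - symplectic_form n"
  by (rule eq_matI) (auto simp: symplectic_form_def)

lemma symplectic_form_square: "symplectic_form n * symplectic_form n = - 1\<^sub>m (2 * n)"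
proof -
  have "symplectic_form n * symplectic_form n = four_block_mat (- 1\<^sub>m n) (0\<^sub>m n n) (0\<^sub>m n n) (- 1\<^sub>m n)"
    unfolding symplectic_form_def by (subst mult_four_block_mat[of _ n n _ n _ n _ _ n _ n]) auto
  also have "\<dots> = - 1\<^sub>m (2 * n)" by (rule eq_matI) auto
  finally show ?thesis .
qed

lemma symplectic_form_inverse:
  "transpose_mat (symplectic_form n) * symplectic_form n = 1\<^sub>m (2 * n)"
  "symplectic_form n * transpose_mat (symplectic_form n) = 1\<^sub>m (2 * n)"
  using carrier_matD[OF symplectic_form_carrier[of n]]
  by (simp_all add: transpose_symplectic_form symplectic_form_square)

lemma diag_block_mat_pair:
  "diag_block_mat [A, B]
    = four_block_mat A (0\<^sub>m (dim_row A) (dim_col B)) (0\<^sub>m (dim_row B) (dim_col A)) B"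
  unfolding diag_block_mat.simps(2)[of A "[B]"] diag_block_mat_singleton Let_def ..

text \<open>The form exchanges the two blocks up to sign, and both blocks are the same
  \<open>D\<close>.\<close>

lemma symplectic_form_commute_diag:
  fixes D :: "real mat"
  assumes "D \<in> carrier_mat n n"
  shows "symplectic_form n * diag_block_mat [D, D] = diag_block_mat [D, D] * symplectic_form n"
proof -
  have D: "diag_block_mat [D, D] = four_block_mat D (0\<^sub>m n n) (0\<^sub>m n n) D"
    unfolding diag_block_mat_pair using assms by simp
  have "- 0\<^sub>m n n = (0\<^sub>m n n :: real mat)" by (rule eq_matI) auto
  then show ?thesis
    unfolding D symplectic_form_def using assms
    by (simp add: mult_four_block_mat[of _ n n _ n _ n _ _ n _ n])
qed

text \<open>The defining equation exhibits \<open>J^T S^T J\<close> as a left inverse of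
  \<open>S\<close>. Being also a right inverse, it shows that the transpose of \<open>S\<close> is
  symplectic too.\<close>

lemma Sp_inverse:
  assumes S: "S \<in> Sp n"
  defines "J \<equiv> symplectic_form n"
  shows "transpose_mat J * (transpose_mat S * J) * S = 1\<^sub>m (2 * n)"
    and "S * (transpose_mat J * (transpose_mat S * J)) = 1\<^sub>m (2 * n)"
    and "S * J * transpose_mat S = J"
proof -
  let ?m = "2 * n"
  note sq = assoc_mult_mat[of _ ?m ?m _ ?m _ ?m] mult_carrier_mat[of _ ?m ?m _ ?m]
  have J: "J \<in> carrier_mat ?m ?m" by (simp add: J_def)
  have Sc: "S \<in> carrier_mat ?m ?m" and SJS: "transpose_mat S * J * S = J" using S by (auto simp: Sp_def J_def)
  have "transpose_mat J * (transpose_mat S * J) * S = transpose_mat J * (transpose_mat S * J * S)"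
    using J Sc by (simp add: sq)
  then show 1: "transpose_mat J * (transpose_mat S * J) * S = 1\<^sub>m ?m"
    unfolding SJS by (simp add: J_def symplectic_form_inverse)
  show 2: "S * (transpose_mat J * (transpose_mat S * J)) = 1\<^sub>m ?m"
    using mat_mult_left_right_inverse[OF _ Sc 1] J Sc by (simp add: sq)
  have "S * transpose_mat J * transpose_mat S = S * (transpose_mat J * (transpose_mat S * (J * transpose_mat J)))"
    using J Sc by (simp add: J_def symplectic_form_inverse) (simp add: sq J_def)
  also have "\<dots> = S * (transpose_mat J * (transpose_mat S * J)) * transpose_mat J"
    using J Sc by (simp add: sq)
  finally have 3: "S * transpose_mat J * transpose_mat S = transpose_mat J" using 2 J by simp
  have "S * J * transpose_mat S = transpose_mat (S * transpose_mat J * transpose_mat S)"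
    using J Sc by (simp add: transpose_mult[of _ ?m ?m _ ?m] sq)
  then show "S * J * transpose_mat S = J" by (simp add: 3)
qed

section \<open>The operator norm and the condition number\<close>

lemma scalar_prod_self_real: "(v :: real vec) \<bullet> v = (\<Sum>i<dim_vec v. (v $ i)\<^sup>2)"
  by (simp add: scalar_prod_def lessThan_atLeast0 power2_eq_square)

lemma scalar_prod_self_nonneg [simp]: "(v :: real vec) \<bullet> v \<ge> 0"
  by (simp add: scalar_prod_self_real sum_nonneg)

lemma scalar_prod_self_pos:
  assumes "(v :: real vec) \<in> carrier_vec m" "v \<noteq> 0\<^sub>v m"
  shows "v \<bullet> v > 0"
proof -
  have "\<exists>i<m. v $ i \<noteq> 0" using assms by (metis eq_vecI carrier_vecD index_zero_vec)
  then obtain i where "i < m" "v $ i \<noteq> 0" by blast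
  then show ?thesis unfolding scalar_prod_self_real using assms
    by (intro sum_pos2[of _ i]) auto
qed

text \<open>A crude entrywise estimate suffices: its only purpose is to make the supremum in
  \<open>op_norm\<close> an actual upper bound.\<close>

lemma bdd_above_op_norm:
  assumes A: "A \<in> carrier_mat k m"
  shows "bdd_above ((\<lambda>v. sqrt ((A *\<^sub>v v) \<bullet> (A *\<^sub>v v))) ` {v \<in> carrier_vec m. sqrt (v \<bullet> v) = (1 :: real)})"
proof (rule bdd_aboveI2)
  fix v :: "real vec" assume "v \<in> {v \<in> carrier_vec m. sqrt (v \<bullet> v) = 1}"
  then have v: "v \<in> carrier_vec m" "v \<bullet> v = 1" by auto
  have vj: "\<bar>v $ j\<bar> \<le> 1" if "j < m" for j
  proof -
    have "(v $ j)\<^sup>2 \<le> v \<bullet> v"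
      unfolding scalar_prod_self_real using v that by (intro member_le_sum) auto
    then show ?thesis by (simp add: v(2) abs_square_le_1)
  qed
  have row: "\<bar>(A *\<^sub>v v) $ i\<bar> \<le> (\<Sum>j<m. \<bar>A $$ (i, j)\<bar>)" if "i < k" for i
  proof -
    have "\<bar>(A *\<^sub>v v) $ i\<bar> \<le> (\<Sum>j<m. \<bar>A $$ (i, j) * v $ j\<bar>)"
      using that A v by (simp add: scalar_prod_def lessThan_atLeast0)
    also have "\<dots> \<le> (\<Sum>j<m. \<bar>A $$ (i, j)\<bar>)"
      using vj by (intro sum_mono) (auto simp: abs_mult intro!: mult_left_le)
    finally show ?thesis .
  qed
  have "((A *\<^sub>v v) $ i)\<^sup>2 \<le> (\<Sum>j<m. \<bar>A $$ (i, j)\<bar>)\<^sup>2" if "i < k" for i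
    unfolding abs_le_square_iff[symmetric] abs_sum_abs by (rule row[OF that])
  then show "sqrt ((A *\<^sub>v v) \<bullet> (A *\<^sub>v v)) \<le> sqrt (\<Sum>i<k. (\<Sum>j<m. \<bar>A $$ (i, j)\<bar>)\<^sup>2)"
    unfolding scalar_prod_self_real using A by (auto intro!: sum_mono simp del: index_mult_mat_vec)
qed

lemma op_norm_bound:
  assumes A: "A \<in> carrier_mat k m" and v: "v \<in> carrier_vec m"
  shows "sqrt ((A *\<^sub>v v) \<bullet> (A *\<^sub>v v)) \<le> op_norm A * sqrt (v \<bullet> v)"
proof (cases "v = 0\<^sub>v m")
  case True
  have "A *\<^sub>v v = 0\<^sub>v k" unfolding True using A by (intro eq_vecI) auto
  then show ?thesis by (simp add: True)
next
  case False
  define r where "r = sqrt (v \<bullet> v)"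
  have r: "r > 0" using scalar_prod_self_pos[OF v False] by (simp add: r_def)
  have sc: "sqrt ((1 / r) * ((1 / r) * x)) = sqrt x / r" for x
    using r by (simp add: real_sqrt_mult real_sqrt_divide)
  define u where "u = (1 / r) \<cdot>\<^sub>v v"
  have u: "u \<in> carrier_vec m" using v by (simp add: u_def)
  have "u \<bullet> u = (1 / r) * ((1 / r) * (v \<bullet> v))" using v by (simp add: u_def)
  then have uu: "sqrt (u \<bullet> u) = 1" using sc[of "v \<bullet> v"] r by (simp only: r_def[symmetric]) simp
  have Av: "A *\<^sub>v v \<in> carrier_vec k" using A v by simp
  have "A *\<^sub>v u = (1 / r) \<cdot>\<^sub>v (A *\<^sub>v v)" unfolding u_def using A v by (rule mult_mat_vec)
  then have "(A *\<^sub>v u) \<bullet> (A *\<^sub>v u) = (1 / r) * ((1 / r) * ((A *\<^sub>v v) \<bullet> (A *\<^sub>v v)))"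
    using Av by (simp del: index_mult_mat_vec)
  then have "sqrt ((A *\<^sub>v u) \<bullet> (A *\<^sub>v u)) = sqrt ((A *\<^sub>v v) \<bullet> (A *\<^sub>v v)) / r"
    by (simp only: sc)
  moreover have "sqrt ((A *\<^sub>v u) \<bullet> (A *\<^sub>v u)) \<le> op_norm A"
    unfolding op_norm_def using A u uu by (intro cSUP_upper bdd_above_op_norm) auto
  ultimately have "sqrt ((A *\<^sub>v v) \<bullet> (A *\<^sub>v v)) / r \<le> op_norm A" by simp
  then show ?thesis unfolding r_def[symmetric] pos_divide_le_eq[OF r] .
qed

text \<open>A matrix without columns would put an empty set under the supremum; otherwise a unit
  vector is a witness.\<close>

lemma op_norm_nonneg:
  assumes A: "A \<in> carrier_mat k m" and m: "m > 0"
  shows "op_norm A \<ge> 0"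
proof -
  have "0 \<le> sqrt ((A *\<^sub>v unit_vec m 0) \<bullet> (A *\<^sub>v unit_vec m 0))" by simp
  also have "\<dots> \<le> op_norm A" using op_norm_bound[OF A, of "unit_vec m 0"] m by simp
  finally show ?thesis .
qed

lemma pos_def_mat_inverse:
  assumes "pos_def_mat m M"
  obtains B where "mat_inverse M = Some B" "B \<in> carrier_mat m m" "M * B = 1\<^sub>m m" "B * M = 1\<^sub>m m"
proof -
  have M: "M \<in> carrier_mat m m" and pos: "\<And>v. v \<in> carrier_vec m \<Longrightarrow> v \<noteq> 0\<^sub>v m \<Longrightarrow> v \<bullet> (M *\<^sub>v v) > 0"
    using assms by (auto simp: pos_def_mat_def)
  have "det M \<noteq> 0"
  proof
    assume "det M = 0"
    then obtain v where "v \<in> carrier_vec m" "v \<noteq> 0\<^sub>v m" "M *\<^sub>v v = 0\<^sub>v m"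
      using det_0_iff_vec_prod_zero_field[OF M] by auto
    then show False using pos[of v] by simp
  qed
  then have "M \<in> Units (ring_mat TYPE(real) m ())" using det_non_zero_imp_unit[OF M, of "()"] by blast
  then obtain B where B: "mat_inverse M = Some B"
    using mat_inverse(1)[OF M, of "()"] by (cases "mat_inverse M") auto
  then show thesis using that mat_inverse(2)[OF M B] by blast
qed

text \<open>Expanding the quadratic form of \<open>M\<close> at \<open>w - \<beta>\<inverse> M\<inverse> w\<close>, with \<open>\<beta>\<close> the norm of the inverse of \<open>M\<close>.\<close>

lemma pos_def_lower_bound:
  assumes M: "pos_def_mat m M" and w: "w \<in> carrier_vec m" and m: "m > 0"
  shows "w \<bullet> w \<le> op_norm (the (mat_inverse M)) * (w \<bullet> (M *\<^sub>v w))"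
proof -
  obtain B where inv: "mat_inverse M = Some B" and B: "B \<in> carrier_mat m m" and MB: "M * B = 1\<^sub>m m"
    using pos_def_mat_inverse[OF M] by metis
  have Mc: "M \<in> carrier_mat m m" and sym: "transpose_mat M = M"
    and pos: "\<And>v. v \<in> carrier_vec m \<Longrightarrow> v \<noteq> 0\<^sub>v m \<Longrightarrow> v \<bullet> (M *\<^sub>v v) > 0"
    using M by (auto simp: pos_def_mat_def)
  have nonneg: "v \<bullet> (M *\<^sub>v v) \<ge> 0" if "v \<in> carrier_vec m" for v
    using pos[OF that] Mc that by (cases "v = 0\<^sub>v m") auto
  define \<beta> where "\<beta> = op_norm B"
  define u where "u = B *\<^sub>v w"
  have u: "u \<in> carrier_vec m" using B w by (simp add: u_def)
  have Mu: "M *\<^sub>v u = w" using Mc B w MB by (simp add: u_def assoc_mult_mat_vec[symmetric, of _ m m _ m] del: assoc_mult_mat_vec)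
  have un: "sqrt (u \<bullet> u) \<le> \<beta> * sqrt (w \<bullet> w)" unfolding u_def \<beta>_def by (rule op_norm_bound[OF B w])
  have \<beta>0: "\<beta> \<ge> 0" unfolding \<beta>_def by (rule op_norm_nonneg[OF B m])
  show ?thesis
  proof (cases "w = 0\<^sub>v m")
    case True
    then show ?thesis using Mc by simp
  next
    case False
    then have ww: "w \<bullet> w > 0" by (rule scalar_prod_self_pos[OF w])
    have "u \<noteq> 0\<^sub>v m" using Mu False Mc by auto
    then have uu: "u \<bullet> u > 0" by (rule scalar_prod_self_pos[OF u])
    have \<beta>: "\<beta> > 0" using un uu ww \<beta>0 by (cases "\<beta> = 0") auto
    have "(sqrt (u \<bullet> u))\<^sup>2 \<le> (\<beta> * sqrt (w \<bullet> w))\<^sup>2" using un uu by (intro power_mono) auto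
    then have un2: "u \<bullet> u \<le> \<beta>\<^sup>2 * (w \<bullet> w)" using uu ww by (simp add: power_mult_distrib)
    have "(w - (1 / \<beta>) \<cdot>\<^sub>v u) \<bullet> (M *\<^sub>v (w - (1 / \<beta>) \<cdot>\<^sub>v u)) \<ge> 0"
      using w u by (intro nonneg) auto
    moreover have "M *\<^sub>v (w - (1 / \<beta>) \<cdot>\<^sub>v u) = M *\<^sub>v w - (1 / \<beta>) \<cdot>\<^sub>v w"
      using Mc w u Mu by (simp add: mult_minus_distrib_mat_vec[of _ m m] mult_mat_vec[of _ m m])
    moreover have "u \<bullet> (M *\<^sub>v w) = w \<bullet> w"
      using transpose_vec_mult_scalar[OF Mc w u] sym Mu by simp
    ultimately have 1: "w \<bullet> (M *\<^sub>v w) - 2 / \<beta> * (w \<bullet> w) + 1 / \<beta>\<^sup>2 * (u \<bullet> w) \<ge> 0"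
      using w u Mc \<beta>
      by (simp add: minus_scalar_prod_distrib[of _ m] scalar_prod_minus_distrib[of _ m] power2_eq_square
          algebra_simps)
    \<comment> \<open>Together with \<open>un2\<close>, this square yields the Cauchy-Schwarz bound
      \<open>u \<bullet> w \<le> \<beta> * (w \<bullet> w)\<close>.\<close>
    have "(\<beta> \<cdot>\<^sub>v w - u) \<bullet> (\<beta> \<cdot>\<^sub>v w - u) \<ge> 0" by simp
    then have "\<beta>\<^sup>2 * (w \<bullet> w) - 2 * \<beta> * (u \<bullet> w) + u \<bullet> u \<ge> 0"
      using w u comm_scalar_prod[OF w u]
      by (simp add: minus_scalar_prod_distrib[of _ m] scalar_prod_minus_distrib[of _ m] power2_eq_square
          algebra_simps)
    then have "2 * \<beta> * (u \<bullet> w) \<le> 2 * \<beta> * (\<beta> * (w \<bullet> w))" using un2 by (simp add: power2_eq_square algebra_simps)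
    then have "u \<bullet> w \<le> \<beta> * (w \<bullet> w)" using \<beta> by simp
    then have "1 / \<beta>\<^sup>2 * (u \<bullet> w) \<le> 1 / \<beta> * (w \<bullet> w)" using \<beta> by (simp add: field_simps power2_eq_square)
    then have "1 / \<beta> * (w \<bullet> w) \<le> w \<bullet> (M *\<^sub>v w)" using 1 by (simp add: mult.commute)
    then show ?thesis using \<beta> by (simp add: inv \<beta>_def[symmetric] field_simps)
  qed
qed

section \<open>Norm bounds for symplectic diagonalisers\<close>

lemma williamson_diagonal:
  assumes "williamson_diag n M D"
  shows "diag_block_mat [D, D] = mat_diag (2 * n) (\<lambda>i. D $$ (i mod n, i mod n))"
proof -
  have D: "D \<in> carrier_mat n n" "diagonal_mat D" using assms by (auto simp: williamson_diag_def)
  have mod: "i mod n = (if i < n then i else i - n)" if "i < 2 * n" for i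
    using that by (auto simp: mod_if)
  show ?thesis unfolding diag_block_mat_pair
    using D by (intro eq_matI) (auto simp: mod diagonal_mat_def)
qed

text \<open>If \<open>S\<^sup>T M S = diag (D, D)\<close>, then \<open>M S v = J\<^sup>T S J diag (D, D) v\<close>. The vectors \<open>S e\<close> and \<open>S J e\<close>,
  with \<open>e\<close> the first basis vector, are therefore swapped by \<open>M\<close> up to the factor \<open>D\<^sub>0\<^sub>0\<close>
  and isometries, so that \<open>D\<^sub>0\<^sub>0\<close> is at most the norm of \<open>M\<close>.\<close>

lemma largest_symplectic_eigenvalue_le:
  assumes M: "M \<in> carrier_mat (2 * n) (2 * n)" and n: "n \<ge> 1" and w: "williamson_diag n M D"
    and S: "S \<in> Sp n" and SMS: "transpose_mat S * M * S = diag_block_mat [D, D]"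
  shows "D $$ (0, 0) \<le> op_norm M"
proof -
  let ?m = "2 * n"
  note sq = assoc_mult_mat[of _ ?m ?m _ ?m _ ?m] mult_carrier_mat[of _ ?m ?m _ ?m]
  note mv = assoc_mult_mat_vec[of _ ?m ?m _ ?m]
  define J where "J = symplectic_form n"
  define T where "T = diag_block_mat [D, D]"
  define d where "d = D $$ (0, 0)"
  have d: "d > 0" using w n by (simp add: d_def williamson_diag_def)
  have J: "J \<in> carrier_mat ?m ?m" by (simp add: J_def)
  have Sc: "S \<in> carrier_mat ?m ?m" using S by (simp add: Sp_def)
  have Dc: "D \<in> carrier_mat n n" using w by (simp add: williamson_diag_def)
  have T: "T \<in> carrier_mat ?m ?m" unfolding T_def williamson_diagonal[OF w] by (rule mat_diag_dim)
  have TJ: "T * J = J * T" unfolding T_def J_def by (rule symplectic_form_commute_diag[OF Dc, symmetric])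
  note JJ = symplectic_form_inverse[of n, folded J_def]
  have SJS: "transpose_mat S * J * S = J" using S by (auto simp: Sp_def J_def)
  note inv = Sp_inverse[OF S, folded J_def]
  \<comment> \<open>As the transpose of \<open>S\<close> is symplectic, its inverse is
    \<open>J^T S J\<close>; applied to \<open>S^T M S = T\<close>, this gives the formula for
    \<open>M S\<close>.\<close>
  have inv3: "transpose_mat J * S * J * transpose_mat S = 1\<^sub>m ?m"
    using inv(3) JJ(1) J Sc by (simp add: sq)
  have MS: "M * S = transpose_mat J * S * J * T"
  proof -
    have "transpose_mat J * S * J * T = transpose_mat J * S * J * transpose_mat S * (M * S)"
      using J Sc M unfolding T_def SMS[symmetric] by (simp add: sq)
    then show ?thesis using inv3 M Sc by simp
  qed
  define e where "e = (unit_vec ?m 0 :: real vec)"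
  have e: "e \<in> carrier_vec ?m" by (simp add: e_def)
  have Te: "T *\<^sub>v e = d \<cdot>\<^sub>v e"
    using n unfolding T_def williamson_diagonal[OF w] e_def d_def
    by (intro eq_vecI) (auto simp: mat_diag_mult_vec simp del: index_mult_mat_vec)
  define p where "p = S *\<^sub>v e"
  define q where "q = S *\<^sub>v (J *\<^sub>v e)"
  have pq: "p \<in> carrier_vec ?m" "q \<in> carrier_vec ?m" using Sc J e by (auto simp: p_def q_def)
  have prods: "transpose_mat J * S \<in> carrier_mat ?m ?m" "transpose_mat J * S * J \<in> carrier_mat ?m ?m"
    using J Sc by (auto simp: sq)
  have MSv: "M *\<^sub>v (S *\<^sub>v v) = transpose_mat J *\<^sub>v (S *\<^sub>v (J *\<^sub>v (T *\<^sub>v v)))" if "v \<in> carrier_vec ?m" for v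
  proof -
    have "M *\<^sub>v (S *\<^sub>v v) = (transpose_mat J * S * J * T) *\<^sub>v v"
      using M Sc that by (simp add: MS[symmetric] mv)
    then show ?thesis using J Sc T prods that by (simp add: mv[of _ T] mv[of _ J] mv[of _ S])
  qed
  have Mp: "M *\<^sub>v p = d \<cdot>\<^sub>v (transpose_mat J *\<^sub>v q)"
    unfolding p_def q_def MSv[OF e] Te using J Sc e by (simp add: mult_mat_vec[of _ ?m ?m])
  have TJe: "T *\<^sub>v (J *\<^sub>v e) = d \<cdot>\<^sub>v (J *\<^sub>v e)"
    using J T e Te by (simp add: mv[symmetric] TJ mult_mat_vec[of _ ?m ?m] del: assoc_mult_mat_vec)
      (simp add: mv mult_mat_vec[of _ ?m ?m])
  have JJe: "J *\<^sub>v (J *\<^sub>v e) = - e"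
    using J e symplectic_form_square[of n]
    by (simp add: mv[symmetric] J_def del: assoc_mult_mat_vec)
  have "M *\<^sub>v q = d \<cdot>\<^sub>v (transpose_mat J *\<^sub>v (S *\<^sub>v (J *\<^sub>v (J *\<^sub>v e))))"
    unfolding q_def MSv[OF mult_mat_vec_carrier[OF J e]] TJe using J Sc e by (simp add: mult_mat_vec[of _ ?m ?m])
  also have "\<dots> = (- d) \<cdot>\<^sub>v (transpose_mat J *\<^sub>v p)"
  proof -
    have "- e = (- 1) \<cdot>\<^sub>v e" by (intro eq_vecI) auto
    then show ?thesis unfolding JJe p_def using J Sc e
      by (simp add: mult_mat_vec[of _ ?m ?m] smult_smult_assoc)
  qed
  finally have Mq: "M *\<^sub>v q = (- d) \<cdot>\<^sub>v (transpose_mat J *\<^sub>v p)" .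
  have iso: "(transpose_mat J *\<^sub>v x) \<bullet> (transpose_mat J *\<^sub>v x) = x \<bullet> x" if "x \<in> carrier_vec ?m" for x
    using transpose_vec_mult_scalar[of "transpose_mat J" ?m ?m x "transpose_mat J *\<^sub>v x"] J that JJ(2)
    by (simp add: mv[symmetric] del: assoc_mult_mat_vec)
  have scaled: "sqrt ((c \<cdot>\<^sub>v (transpose_mat J *\<^sub>v x)) \<bullet> (c \<cdot>\<^sub>v (transpose_mat J *\<^sub>v x))) = \<bar>c\<bar> * sqrt (x \<bullet> x)"
    if "x \<in> carrier_vec ?m" for x c
    using J that by (simp add: iso real_sqrt_mult mult.assoc[symmetric])
  have 1: "d * sqrt (q \<bullet> q) \<le> op_norm M * sqrt (p \<bullet> p)"
    using op_norm_bound[OF M pq(1)] d unfolding Mp scaled[OF pq(2)] by simp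
  have 2: "d * sqrt (p \<bullet> p) \<le> op_norm M * sqrt (q \<bullet> q)"
    using op_norm_bound[OF M pq(2)] d unfolding Mq scaled[OF pq(1)] by simp
  have "p \<noteq> 0\<^sub>v ?m"
  proof
    assume p0: "p = 0\<^sub>v ?m"
    have "e = transpose_mat J * (transpose_mat S * J) *\<^sub>v p"
      unfolding p_def using inv(1) J Sc e by (simp add: mv[symmetric] sq del: assoc_mult_mat_vec)
    then have "e = 0\<^sub>v ?m" unfolding p0 using J Sc by (auto simp: sq)
    then show False using n by (auto simp: e_def)
  qed
  then have pp: "sqrt (p \<bullet> p) > 0" using scalar_prod_self_pos[OF pq(1)] by simp
  have M0: "op_norm M \<ge> 0" using op_norm_nonneg[OF M] n by simp
  \<comment> \<open>Each of the two inequalities exchanges the lengths of \<open>p\<close> and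
    \<open>q\<close> at the cost of a factor \<open>op_norm M / d\<close>; their composition returns
    to \<open>p\<close>, whose length cancels.\<close>
  have "d * (d * sqrt (p \<bullet> p)) \<le> d * (op_norm M * sqrt (q \<bullet> q))" using 2 d by (intro mult_left_mono) auto
  also have "\<dots> = op_norm M * (d * sqrt (q \<bullet> q))" by simp
  also have "\<dots> \<le> op_norm M * (op_norm M * sqrt (p \<bullet> p))" using 1 M0 by (intro mult_left_mono)
  finally have "d\<^sup>2 * sqrt (p \<bullet> p) \<le> (op_norm M)\<^sup>2 * sqrt (p \<bullet> p)" by (simp add: power2_eq_square)
  then have "d\<^sup>2 \<le> (op_norm M)\<^sup>2" using pp by simp
  then show ?thesis unfolding d_def[symmetric] using M0 by (rule power2_le_imp_le)
qed

text \<open>For \<open>w = S v\<close>, the square of the length of \<open>w\<close> is at most the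
  norm of the inverse of \<open>M\<close> times \<open>w \<bullet> (M w)\<close>. The latter equals
  the form of \<open>diag (D, D)\<close> at \<open>v\<close>, whose coefficients are at most the
  norm of \<open>M\<close>.\<close>

lemma symplectic_diagonaliser_bound:
  assumes M: "pos_def_mat (2 * n) M" and n: "n \<ge> 1" and w: "williamson_diag n M D"
    and S: "S \<in> Sp n" and SMS: "transpose_mat S * M * S = diag_block_mat [D, D]"
    and v: "v \<in> carrier_vec (2 * n)"
  shows "(S *\<^sub>v v) \<bullet> (S *\<^sub>v v) \<le> cond_number M * (v \<bullet> v)"
proof -
  let ?m = "2 * n"
  note mv = assoc_mult_mat_vec[of _ ?m ?m _ ?m]
  have Mc: "M \<in> carrier_mat ?m ?m" using M by (simp add: pos_def_mat_def)
  have Sc: "S \<in> carrier_mat ?m ?m" using S by (simp add: Sp_def)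
  have Sv: "S *\<^sub>v v \<in> carrier_vec ?m" using Sc v by simp
  define d where "d i = D $$ (i mod n, i mod n)" for i
  have d: "d i \<le> op_norm M" if "i < ?m" for i
  proof -
    have "d i \<le> D $$ (0, 0)" using w n by (auto simp: d_def williamson_diag_def)
    then show ?thesis using largest_symplectic_eigenvalue_le[OF Mc n w S SMS] by simp
  qed
  obtain B where B: "mat_inverse M = Some B" "B \<in> carrier_mat ?m ?m" using pos_def_mat_inverse[OF M] by metis
  have B0: "op_norm (the (mat_inverse M)) \<ge> 0" using op_norm_nonneg[OF B(2)] B(1) n by simp
  have "(S *\<^sub>v v) \<bullet> (M *\<^sub>v (S *\<^sub>v v)) = v \<bullet> (transpose_mat S *\<^sub>v (M *\<^sub>v (S *\<^sub>v v)))"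
    using transpose_vec_mult_scalar[of "transpose_mat S" ?m ?m "M *\<^sub>v (S *\<^sub>v v)" v] Sc Mc v by simp
  also have "transpose_mat S *\<^sub>v (M *\<^sub>v (S *\<^sub>v v)) = mat_diag ?m d *\<^sub>v v"
    unfolding d_def williamson_diagonal[OF w, symmetric] SMS[symmetric] using Sc Mc v
    by (simp add: mv mult_carrier_mat[of _ ?m ?m _ ?m])
  also have "v \<bullet> (mat_diag ?m d *\<^sub>v v) = (\<Sum>i<?m. d i * (v $ i)\<^sup>2)"
    using v by (auto simp: scalar_prod_def[of v] lessThan_atLeast0 mat_diag_mult_vec power2_eq_square
        simp del: index_mult_mat_vec intro!: sum.cong)
  also have "\<dots> \<le> (\<Sum>i<?m. op_norm M * (v $ i)\<^sup>2)"
    using d by (intro sum_mono mult_right_mono) auto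
  also have "\<dots> = op_norm M * (v \<bullet> v)" using v by (simp add: scalar_prod_self_real sum_distrib_left)
  finally have "op_norm (the (mat_inverse M)) * ((S *\<^sub>v v) \<bullet> (M *\<^sub>v (S *\<^sub>v v)))
      \<le> op_norm (the (mat_inverse M)) * (op_norm M * (v \<bullet> v))"
    using B0 by (rule mult_left_mono)
  with pos_def_lower_bound[OF M Sv] n show ?thesis by (simp add: cond_number_def mult_ac)
qed

text \<open>A real matrix acts separately on real and imaginary parts, which carries the real bound
  over to the complex vectors on which the norm estimates rely.\<close>

lemma Re_cscalar_of_real_mult:
  fixes v :: "complex vec" and S :: "real mat"
  assumes S: "S \<in> carrier_mat k m" and v: "v \<in> carrier_vec m"
  shows "Re ((map_mat complex_of_real S *\<^sub>v v) \<bullet>c (map_mat complex_of_real S *\<^sub>v v))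
    = (S *\<^sub>v map_vec Re v) \<bullet> (S *\<^sub>v map_vec Re v) + (S *\<^sub>v map_vec Im v) \<bullet> (S *\<^sub>v map_vec Im v)"
proof -
  have "Re ((map_mat complex_of_real S *\<^sub>v v) $ i) = (S *\<^sub>v map_vec Re v) $ i"
    "Im ((map_mat complex_of_real S *\<^sub>v v) $ i) = (S *\<^sub>v map_vec Im v) $ i" if "i < k" for i
    using S v that by (simp_all add: scalar_prod_def)
  then show ?thesis
    unfolding Re_cscalar_self scalar_prod_self_real using S
    by (simp add: cmod_power2 sum.distrib del: index_mult_mat_vec)
qed

lemma Re_cscalar_self_split:
  "Re ((v :: complex vec) \<bullet>c v) = map_vec Re v \<bullet> map_vec Re v + map_vec Im v \<bullet> map_vec Im v"
  by (simp add: Re_cscalar_self scalar_prod_self_real cmod_power2 sum.distrib)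

lemma symplectic_diagonaliser_bound_complex:
  assumes M: "pos_def_mat (2 * n) M" and n: "n \<ge> 1" and w: "williamson_diag n M D"
    and S: "S \<in> Sp n" and SMS: "transpose_mat S * M * S = diag_block_mat [D, D]"
    and v: "v \<in> carrier_vec (2 * n)"
  shows "Re ((map_mat complex_of_real S *\<^sub>v v) \<bullet>c (map_mat complex_of_real S *\<^sub>v v))
    \<le> cond_number M * Re (v \<bullet>c v)"
proof -
  have Sc: "S \<in> carrier_mat (2 * n) (2 * n)" using S by (simp add: Sp_def)
  show ?thesis
    unfolding Re_cscalar_of_real_mult[OF Sc v] Re_cscalar_self_split[of v] distrib_left using v
    by (intro add_mono symplectic_diagonaliser_bound[OF M n w S SMS]) auto
qed

lemma cond_number_nonneg:
  assumes M: "pos_def_mat m M" and m: "m > 0"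
  shows "cond_number M \<ge> 0"
proof -
  obtain B where "mat_inverse M = Some B" "B \<in> carrier_mat m m" using pos_def_mat_inverse[OF M] by metis
  then show ?thesis using op_norm_nonneg[of _ m m] m M by (simp add: cond_number_def pos_def_mat_def)
qed

section \<open>Spectral decomposition of \<open>i J^T diag (D, D)\<close>\<close>

lemma mat_diag_split:
  "mat_diag (2 * n) f = four_block_mat (mat_diag n f) (mat_diag n (\<lambda>_. 0)) (mat_diag n (\<lambda>_. 0))
    (mat_diag n (\<lambda>i. f (n + i)))"
  by (rule eq_matI) auto

text \<open>The columns of this matrix are the normalised vectors \<open>e\<^sub>j \<plusminus> i e\<^bsub>n+j\<^esub>\<close>.\<close>

definition block_rotation :: "nat \<Rightarrow> complex mat" where
  "block_rotation n = (let s = complex_of_real (1 / sqrt 2) in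
    four_block_mat (mat_diag n (\<lambda>_. s)) (mat_diag n (\<lambda>_. s))
      (mat_diag n (\<lambda>_. s * \<i>)) (mat_diag n (\<lambda>_. - s * \<i>)))"

lemma half_eq: "complex_of_real (1 / sqrt 2) * complex_of_real (1 / sqrt 2) = 1 / 2"
  by (simp flip: of_real_mult)

lemma block_rotation_adjoint:
  "mat_adjoint (block_rotation n) = (let s = complex_of_real (1 / sqrt 2) in
    four_block_mat (mat_diag n (\<lambda>_. s)) (mat_diag n (\<lambda>_. - s * \<i>))
      (mat_diag n (\<lambda>_. s)) (mat_diag n (\<lambda>_. s * \<i>)))"
  by (rule eq_matI) (auto simp: block_rotation_def Let_def)

lemma block_mat_diag_mult:
  "four_block_mat (mat_diag n a) (mat_diag n b) (mat_diag n c) (mat_diag n d)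
    * four_block_mat (mat_diag n a') (mat_diag n b') (mat_diag n c') (mat_diag n d')
    = four_block_mat (mat_diag n (\<lambda>i. a i * a' i + b i * c' i)) (mat_diag n (\<lambda>i. a i * b' i + b i * d' i))
      (mat_diag n (\<lambda>i. c i * a' i + d i * c' i)) (mat_diag n (\<lambda>i. c i * b' i + d i * d' i :: 'a :: semiring_1))"
  by (subst mult_four_block_mat[of _ n n _ n _ n _ _ n _ n]) (auto simp: mat_diag_add)

lemma unitary_block_rotation: "unitary_mat (2 * n) (block_rotation n)"
proof (rule unitary_matI)
  show "block_rotation n \<in> carrier_mat (2 * n) (2 * n)"
    unfolding block_rotation_def Let_def mult_2 by (intro four_block_carrier_mat) auto
  let ?s = "complex_of_real (1 / sqrt 2)"
  have "mat_adjoint (block_rotation n) * block_rotation n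
      = four_block_mat (mat_diag n (\<lambda>_. 1)) (mat_diag n (\<lambda>_. 0)) (mat_diag n (\<lambda>_. 0)) (mat_diag n (\<lambda>_. 1))"
    unfolding block_rotation_adjoint unfolding block_rotation_def Let_def block_mat_diag_mult
  proof (intro arg_cong4[of _ _ _ _ _ _ _ _ four_block_mat] mat_diag_cong)
    have 1: "- ?s * \<i> * (?s * \<i>) = ?s * ?s" "- ?s * \<i> * (- ?s * \<i>) = - (?s * ?s)" 
      "?s * \<i> * (?s * \<i>) = - (?s * ?s)" "?s * \<i> * (- ?s * \<i>) = ?s * ?s"
      by (simp_all add: algebra_simps)
    show "?s * ?s + - ?s * \<i> * (?s * \<i>) = 1" "?s * ?s + - ?s * \<i> * (- ?s * \<i>) = 0"
      "?s * ?s + ?s * \<i> * (?s * \<i>) = 0" "?s * ?s + ?s * \<i> * (- ?s * \<i>) = 1"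
      unfolding 1 half_eq by simp_all
  qed
  also have "\<dots> = 1\<^sub>m (2 * n)" using mat_diag_split[of n "\<lambda>_. 1 :: complex"] by simp
  finally show "mat_adjoint (block_rotation n) * block_rotation n = 1\<^sub>m (2 * n)" .
qed

text \<open>The order follows the columns of \<open>block_rotation\<close>: positive eigenvalues
  first, then their negatives in the same order.\<close>

definition signed_spectrum :: "nat \<Rightarrow> real mat \<Rightarrow> nat \<Rightarrow> real" where
  "signed_spectrum n D i = (if i < n then D $$ (i, i) else - D $$ (i - n, i - n))"

text \<open>On the plane of \<open>e_j\<close> and \<open>e_{n+j}\<close> the matrix is
  \<open>D_jj\<close> times the second Pauli matrix, with eigenvectors \<open>(1, i)\<close> for
  \<open>D_jj\<close> and \<open>(1, -i)\<close> for \<open>- D_jj\<close>.\<close>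

lemma symplectic_hermitian_diagonalization:
  assumes w: "williamson_diag n M D"
  shows "\<i> \<cdot>\<^sub>m map_mat complex_of_real (transpose_mat (symplectic_form n) * diag_block_mat [D, D])
    = block_rotation n * mat_diag (2 * n) (\<lambda>i. complex_of_real (signed_spectrum n D i))
      * mat_adjoint (block_rotation n)"
proof -
  let ?s = "complex_of_real (1 / sqrt 2)"
  let ?d = "\<lambda>i. complex_of_real (D $$ (i, i))"
  have "block_rotation n * mat_diag (2 * n) (\<lambda>i. complex_of_real (signed_spectrum n D i))
      * mat_adjoint (block_rotation n)
      = four_block_mat (mat_diag n (\<lambda>_. 0)) (mat_diag n (\<lambda>i. - \<i> * ?d i))
          (mat_diag n (\<lambda>i. \<i> * ?d i)) (mat_diag n (\<lambda>_. 0))"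
    unfolding block_rotation_adjoint unfolding block_rotation_def mat_diag_split Let_def block_mat_diag_mult
  proof (intro arg_cong4[of _ _ _ _ _ _ _ _ four_block_mat] mat_diag_cong, goal_cases)
    case (1 i)
    then show ?case by (simp add: signed_spectrum_def)
  next
    case (2 i)
    have "?s * ?d i * (- ?s * \<i>) + ?s * - ?d i * (?s * \<i>) = - 2 * (?s * ?s) * \<i> * ?d i"
      by (simp add: algebra_simps)
    then show ?case using 2 unfolding half_eq by (simp add: signed_spectrum_def)
  next
    case (3 i)
    have "?s * \<i> * ?d i * ?s + - ?s * \<i> * - ?d i * ?s = 2 * (?s * ?s) * \<i> * ?d i"
      by (simp add: algebra_simps)
    then show ?case using 3 unfolding half_eq by (simp add: signed_spectrum_def)
  next
    case (4 i)
    then show ?case by (simp add: signed_spectrum_def)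
  qed
  also have "\<dots> = \<i> \<cdot>\<^sub>m map_mat complex_of_real (transpose_mat (symplectic_form n) * diag_block_mat [D, D])"
    unfolding williamson_diagonal[OF w] mat_diag_mult_right[OF transpose_carrier_mat[THEN iffD2, OF symplectic_form_carrier]]
    by (rule eq_matI) (auto simp: symplectic_form_def mod_if)
  finally show ?thesis ..
qed

text \<open>The negated eigenvalues in the second half increase, so reflecting the positions
  \<open>n\<close> to \<open>2 * n - 1\<close> sorts the whole list. The permutation depends on
  \<open>n\<close> alone and hence serves both spectra.\<close>

lemma reverse_second_half_permutes:
  fixes n :: nat
  shows
  "(\<lambda>k. if n \<le> k \<and> k < 2 * n then 3 * n - 1 - k else k) permutes {..<2 * n}"
  (is "?q permutes _")
proof -
  define q where "q = ?q"
  have inv: "q (q k) = k" for k by (auto simp: q_def)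
  have out: "q k = k" if "k \<notin> {..<2 * n}" for k using that by (auto simp: q_def)
  have "q permutes {..<2 * n}" unfolding permutes_def
  proof (intro conjI allI impI)
    show "\<exists>!x. q x = y" for y using inv by (intro ex1I[of _ "q y"]) (auto dest: arg_cong[of _ _ q])
  qed (rule out)
  then show ?thesis by (simp only: q_def)
qed

lemma signed_spectrum_sorted:
  assumes w: "williamson_diag n M D" and ij: "i \<le> j" "j < 2 * n"
  defines "q \<equiv> \<lambda>k. if n \<le> k \<and> k < 2 * n then 3 * n - 1 - k else k"
  shows "signed_spectrum n D (q j) \<le> signed_spectrum n D (q i)"
proof -
  have pos: "D $$ (i, i) > 0" if "i < n" for i using w that by (simp add: williamson_diag_def)
  have mono: "D $$ (j, j) \<le> D $$ (i, i)" if "i \<le> j" "j < n" for i j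
    using w that by (simp add: williamson_diag_def)
  have q: "signed_spectrum n D (q k) = (if k < n then D $$ (k, k) else - D $$ (2 * n - 1 - k, 2 * n - 1 - k))"
    if "k < 2 * n" for k
  proof (cases "k < n")
    case False
    then have "3 * n - 1 - k - n = 2 * n - 1 - k" "\<not> 3 * n - 1 - k < n" using that by auto
    then show ?thesis using False that by (simp add: q_def signed_spectrum_def)
  qed (simp add: q_def signed_spectrum_def)
  consider "j < n" | "i < n" "n \<le> j" | "n \<le> i" using ij by linarith
  then show ?thesis
  proof cases
    case 1
    then show ?thesis using mono ij by (simp add: q)
  next
    case 2
    then have "0 < D $$ (i, i)" "0 < D $$ (2 * n - 1 - j, 2 * n - 1 - j)" using ij by (auto intro!: pos)
    then show ?thesis using 2 ij by (simp add: q)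
  next
    case 3
    then show ?thesis using mono[of "2 * n - 1 - j" "2 * n - 1 - i"] ij by (simp add: q)
  qed
qed

theorem theorem3p1:
  fixes n :: nat and M M' D D' :: "real mat" and N :: "complex mat \<Rightarrow> real"
  assumes "n \<ge> 1"
    and "pos_def_mat (2 * n) M" and "pos_def_mat (2 * n) M'"
    and "williamson_diag n M D" and "williamson_diag n M' D'"
    and "unitarily_invariant_norm (2 * n) N"
  shows "N (map_mat complex_of_real (diag_block_mat [D, D] - diag_block_mat [D', D']))
           \<le> sqrt (cond_number M * cond_number M') * N (map_mat complex_of_real (M - M'))"
proof -
  let ?m = "2 * n"
  let ?C = "map_mat complex_of_real"
  note n = assms(1) and M = assms(2) and M' = assms(3) and w = assms(4) and w' = assms(5) and N = assms(6)
  note assoc = assoc_mult_mat[of _ ?m ?m _ ?m _ ?m] and carr = mult_carrier_mat[of _ ?m ?m _ ?m]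
  note sq = assoc carr
  have C_mult: "?C (A * B) = ?C A * ?C B" if "A \<in> carrier_mat ?m ?m" "B \<in> carrier_mat ?m ?m" for A B
    using that by (rule of_real_hom.mat_hom_mult)
  note minus_left = mult_minus_distrib_mat[of _ ?m ?m _ ?m] and minus_right = minus_mult_distrib_mat[of _ ?m ?m _ _ ?m]
  have C_minus: "?C (A - B) = ?C A - ?C B" if "A \<in> carrier_mat ?m ?m" "B \<in> carrier_mat ?m ?m" for A B
    using that by (intro eq_matI) auto
  obtain S where S: "S \<in> Sp n" and SMS: "transpose_mat S * M * S = diag_block_mat [D, D]"
    using w by (auto simp: williamson_diag_def)
  obtain S' where S': "S' \<in> Sp n" and SMS': "transpose_mat S' * M' * S' = diag_block_mat [D', D']"
    using w' by (auto simp: williamson_diag_def)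
  define J where "J = symplectic_form n"
  define K where "K = transpose_mat J"
  define T where "T = diag_block_mat [D, D]"
  define T' where "T' = diag_block_mat [D', D']"
  define R where "R = transpose_mat S"
  define R' where "R' = transpose_mat S'"
  have Mc: "M \<in> carrier_mat ?m ?m" "M' \<in> carrier_mat ?m ?m" using M M' by (auto simp: pos_def_mat_def)
  have Jc: "J \<in> carrier_mat ?m ?m" "K \<in> carrier_mat ?m ?m" by (simp_all add: J_def K_def)
  have Sc: "S \<in> carrier_mat ?m ?m" "S' \<in> carrier_mat ?m ?m" "R \<in> carrier_mat ?m ?m" "R' \<in> carrier_mat ?m ?m"
    using S S' by (auto simp: Sp_def R_def R'_def)
  have Tc: "T \<in> carrier_mat ?m ?m" "T' \<in> carrier_mat ?m ?m"
    unfolding T_def T'_def williamson_diagonal[OF w] williamson_diagonal[OF w'] by (auto simp: mat_diag_dim)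
  have Dc: "D \<in> carrier_mat n n" "D' \<in> carrier_mat n n" using w w' by (auto simp: williamson_diag_def)
  note cs = Mc Jc Sc Tc
  have JK: "K * J = 1\<^sub>m ?m" "J * K = 1\<^sub>m ?m" using symplectic_form_inverse by (auto simp: J_def K_def)
  have Kneg: "K = - J" by (simp add: K_def J_def transpose_symplectic_form)
  have JT: "J * T = T * J" "J * T' = T' * J"
    using symplectic_form_commute_diag Dc by (auto simp: J_def T_def T'_def)
  have KT: "K * T = T * K" "K * T' = T' * K" using JT cs by (auto simp: Kneg)
  have Tsym: "transpose_mat T = T" "transpose_mat T' = T'"
    unfolding T_def T'_def williamson_diagonal[OF w] williamson_diagonal[OF w'] by (auto intro!: eq_matI)
  note inv = Sp_inverse[OF S, folded J_def, folded K_def R_def]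
  note inv' = Sp_inverse[OF S', folded J_def, folded K_def R'_def]
  \<comment> \<open>\<open>X\<close> is \<open>S^{-1} S'\<close> with the inverse written through
    the form, and \<open>Y\<close> is its inverse transpose \<open>S^T S'^{-T}\<close>.\<close>
  define X where "X = K * (R * J) * S'"
  define Y where "Y = R * J * S' * K"
  have XY: "X \<in> carrier_mat ?m ?m" "Y \<in> carrier_mat ?m ?m" using cs by (auto simp: X_def Y_def sq)
  have YX: "Y = J * X * K"
  proof -
    have "J * X * K = (J * K) * (R * (J * (S' * K)))" unfolding X_def using cs by (simp add: sq)
    then show ?thesis unfolding JK Y_def using cs by (simp add: sq)
  qed
  have XtY: "transpose_mat X * Y = 1\<^sub>m ?m"
  proof -
    have "transpose_mat X = R' * (K * (S * J))"
      unfolding X_def using cs by (simp add: transpose_mult[of _ ?m ?m _ ?m] sq K_def R_def R'_def)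
    then have "transpose_mat X * Y = R' * (K * ((S * J * R) * (J * (S' * K))))"
      unfolding Y_def using cs by (simp add: sq)
    also have "\<dots> = R' * ((K * J) * (J * (S' * K)))" unfolding inv(3) using cs by (simp add: sq)
    also have "\<dots> = (R' * J * S') * K" unfolding JK using cs by (simp add: sq)
    also have "R' * J * S' = J" using S' by (simp add: Sp_def R'_def J_def)
    finally show ?thesis by (simp add: JK)
  qed
  \<comment> \<open>The two terms use different sides: \<open>S^T M = T S^{-1}\<close> produces
    \<open>T X\<close>, whereas \<open>M' S' = S'^{-T} T'\<close> produces
    \<open>Y T'\<close>.\<close>
  define W where "W = R * (M - M') * S'"
  have RM: "R * M * S' = T * X"
  proof -
    have "T * X = R * M * (S * (K * (R * J))) * S'"
      unfolding X_def T_def SMS[symmetric, folded R_def] using cs by (simp add: sq)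
    then show ?thesis unfolding inv(2) using cs by (simp add: sq)
  qed
  have RM': "R * M' * S' = Y * T'"
  proof -
    have "Y * T' = R * (J * ((S' * K * R') * (M' * S')))"
      unfolding Y_def T'_def SMS'[symmetric, folded R'_def] using cs by (simp add: sq)
    also have "S' * K * R' = - (S' * J * R')" using cs by (simp add: Kneg)
    also have "\<dots> = K" by (simp add: inv'(3) Kneg)
    also have "R * (J * (K * (M' * S'))) = R * ((J * K) * (M' * S'))" using cs by (simp add: sq)
    finally show ?thesis unfolding JK using cs by (simp add: sq)
  qed
  have W: "W = T * X - Y * T'"
    unfolding W_def RM[symmetric] RM'[symmetric] using cs by (simp add: minus_left minus_right sq)
  have Wc: "W \<in> carrier_mat ?m ?m" unfolding W_def using cs by (auto simp: sq intro!: minus_carrier_mat)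
  define H where "H = \<i> \<cdot>\<^sub>m ?C (K * T)"
  define H' where "H' = \<i> \<cdot>\<^sub>m ?C (K * T')"
  have Hc: "H \<in> carrier_mat ?m ?m" "H' \<in> carrier_mat ?m ?m" using cs by (auto simp: H_def H'_def sq)
  have skew: "transpose_mat (K * T) = - (K * T)" "transpose_mat (K * T') = - (K * T')"
    using cs JT by (auto simp: transpose_mult[of _ ?m ?m _ ?m] Tsym K_def)
      (auto simp: K_def[symmetric] Kneg)
  have Hh: "mat_adjoint H = H" "mat_adjoint H' = H'"
    unfolding H_def H'_def mat_adjoint_smult mat_adjoint_of_real skew using cs by (auto intro!: eq_matI simp del: index_mult_mat(1))
  have HZ: "H * ?C Z - ?C Z * H' = \<i> \<cdot>\<^sub>m ?C (K * T * Z - Z * (K * T'))" if Z: "Z \<in> carrier_mat ?m ?m" for Z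
  proof -
    have c: "K * T \<in> carrier_mat ?m ?m" "K * T' \<in> carrier_mat ?m ?m"
      "K * T * Z \<in> carrier_mat ?m ?m" "Z * (K * T') \<in> carrier_mat ?m ?m" using cs Z by (auto simp: sq)
    have "H * ?C Z = \<i> \<cdot>\<^sub>m ?C (K * T * Z)"
      unfolding H_def C_mult[OF c(1) Z] using c Z by (intro mult_smult_assoc_mat[of _ ?m ?m _ ?m]) auto
    moreover have "?C Z * H' = \<i> \<cdot>\<^sub>m ?C (Z * (K * T'))"
      unfolding H'_def C_mult[OF Z c(2)] using c Z by (intro mult_smult_distrib[of _ ?m ?m _ ?m]) auto
    ultimately show ?thesis unfolding C_minus[OF c(3,4)] using cs Z
      by (intro eq_matI) (auto simp: algebra_simps simp del: index_mult_mat(1))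
  qed
  have uJ: "unitary_mat ?m (?C J)" "unitary_mat ?m (?C K)"
    using Jc by (auto intro!: unitary_matI simp: mat_adjoint_of_real C_mult[symmetric] JK K_def[symmetric] of_real_hom.mat_hom_one)
      (simp add: K_def C_mult[symmetric] of_real_hom.mat_hom_one JK(2)[unfolded K_def])
  \<comment> \<open>Since \<open>K * Y = X * K\<close>, multiplication by \<open>K\<close> leaves
    \<open>X\<close> in both terms and turns \<open>T\<close> and \<open>T'\<close> into
    \<open>K * T\<close> and \<open>K * T'\<close>, which the factor \<open>i\<close> makes
    Hermitian.\<close>
  have KW: "K * T * X - X * (K * T') = K * W"
  proof -
    have "K * (Y * T') = (K * J) * (X * (K * T'))" unfolding YX using cs XY by (simp add: sq)
    then have "K * (Y * T') = X * (K * T')" unfolding JK using cs XY by (simp add: sq)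
    then show ?thesis unfolding W using cs XY by (simp add: minus_left sq)
  qed
  have NW: "N (H * ?C X - ?C X * H') = N (?C W)"
  proof -
    have "N (H * ?C X - ?C X * H') = cmod \<i> * N (?C (K * W))"
      unfolding HZ[OF XY(1)] KW using cs Wc by (intro uin_smult[OF N]) (auto simp: sq)
    then show ?thesis unfolding C_mult[OF Jc(2) Wc] using uin_unitary_left[OF N _ uJ(2), of "?C W"] Wc by simp
  qed
  \<comment> \<open>Both \<open>K * T\<close> and \<open>K * T'\<close> commute with
    \<open>J\<close>, so the unitary factors in \<open>Y = J * X * K\<close> can be pulled out on
    the two sides.\<close>
  have KTY: "K * T * Y - Y * (K * T') = J * (K * W) * K"
  proof -
    have a: "K * T * Y = J * (K * T * X) * K"
    proof -
      have "K * T * Y = K * (T * J) * (X * K)" unfolding YX using cs XY by (simp add: sq)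
      also have "\<dots> = (K * J) * (T * (X * K))" unfolding JT[symmetric] using cs XY by (simp add: sq)
      also have "\<dots> = (J * K) * (T * (X * K))" by (simp only: JK)
      finally show ?thesis using cs XY by (simp add: sq)
    qed
    have b: "Y * (K * T') = J * (X * (K * T')) * K"
      unfolding YX using cs XY by (simp add: sq KT(2)[symmetric])
    have c: "K * T * X \<in> carrier_mat ?m ?m" "X * (K * T') \<in> carrier_mat ?m ?m"
      "J * (K * T * X) \<in> carrier_mat ?m ?m" "J * (X * (K * T')) \<in> carrier_mat ?m ?m"
      using cs XY by (auto simp: sq)
    show ?thesis unfolding a b KW[symmetric] using c Jc by (simp add: minus_left minus_right)
  qed
  have NY: "N (H * ?C Y - ?C Y * H') = N (?C W)"
  proof -
    have KWc: "K * W \<in> carrier_mat ?m ?m" "J * (K * W) \<in> carrier_mat ?m ?m" "J * (K * W) * K \<in> carrier_mat ?m ?m"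
      using cs Wc by (auto simp: sq)
    have "N (H * ?C Y - ?C Y * H') = cmod \<i> * N (?C (J * (K * W) * K))"
      unfolding HZ[OF XY(2)] KTY using KWc by (intro uin_smult[OF N]) auto
    also have "\<dots> = N (?C J * (?C K * ?C W) * ?C K)"
      using cs Wc KWc by (simp add: C_mult)
    also have "\<dots> = N (?C K * ?C W)"
      using cs Wc by (intro uin_unitary[OF N _ uJ]) (auto simp: carr)
    also have "\<dots> = N (?C W)" using Wc by (intro uin_unitary_left[OF N _ uJ(2)]) auto
    finally show ?thesis .
  qed
  have "mat_adjoint (?C X) * ?C Y = 1\<^sub>m ?m"
    unfolding mat_adjoint_of_real using XY by (simp add: C_mult[symmetric] XtY of_real_hom.mat_hom_one)
  then obtain U V where U: "unitary_mat ?m U" and V: "unitary_mat ?m V"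
    and UV: "N (U * H * mat_adjoint U - V * H' * mat_adjoint V) \<le> N (?C W)"
    using uin_sylvester_ge[OF N Hc(1) Hh(1) Hc(2) Hh(2), of "?C X" "?C Y"] XY by (auto simp: NW NY)
  define P where "P = block_rotation n"
  define a where "a = signed_spectrum n D"
  define a' where "a' = signed_spectrum n D'"
  have P: "unitary_mat ?m P" unfolding P_def by (rule unitary_block_rotation)
  note Pc = unitary_matD(1)[OF P] and Uc = unitary_matD(1)[OF U] and Vc = unitary_matD(1)[OF V]
  have HP: "H = P * mat_diag ?m (\<lambda>i. complex_of_real (a i)) * mat_adjoint P"
    unfolding H_def K_def J_def T_def P_def a_def by (rule symplectic_hermitian_diagonalization[OF w])
  have HP': "H' = P * mat_diag ?m (\<lambda>i. complex_of_real (a' i)) * mat_adjoint P"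
    unfolding H'_def K_def J_def T'_def P_def a'_def by (rule symplectic_hermitian_diagonalization[OF w'])
  have conj: "Q * (P * F * mat_adjoint P) * mat_adjoint Q = (Q * P) * F * mat_adjoint (Q * P)"
    if "Q \<in> carrier_mat ?m ?m" "F \<in> carrier_mat ?m ?m" for Q F
    using that Pc by (simp add: sq mat_adjoint_mult[of _ ?m ?m _ ?m])
  \<comment> \<open>\<open>K\<close> is unitary and \<open>i\<close> has modulus one, so this norm
    is that of \<open>H - H'\<close>. As the same \<open>P\<close> diagonalises both, the left-hand
    side of the claim becomes the norm of the difference of the signed spectra.\<close>
  have "N (?C (T - T')) = N (?C (K * (T - T')))"
    unfolding C_mult[OF Jc(2) minus_carrier_mat[OF Tc(2)]]
    using Tc by (intro uin_unitary_left[OF N _ uJ(2), symmetric]) (auto intro!: minus_carrier_mat)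
  also have "\<dots> = N (\<i> \<cdot>\<^sub>m ?C (K * (T - T')))"
    using uin_smult[OF N, of "?C (K * (T - T'))" \<i>] cs by (simp add: carr minus_carrier_mat)
  also have "\<i> \<cdot>\<^sub>m ?C (K * (T - T')) = H - H'"
    unfolding H_def H'_def mult_minus_distrib_mat[OF Jc(2) Tc] using cs
    by (intro eq_matI) (auto simp: algebra_simps simp del: index_mult_mat(1))
  also have "\<dots> = P * mat_diag ?m (\<lambda>i. complex_of_real (a i - a' i)) * mat_adjoint P"
    unfolding HP HP' using Pc
    by (simp add: mat_diag_minus[symmetric] minus_left minus_right carr minus_carrier_mat)
  also have "N \<dots> = N (mat_diag ?m (\<lambda>i. complex_of_real (a i - a' i)))"
    by (intro uin_unitary[OF N] P unitary_mat_adjoint) simp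
  also have "\<dots> \<le> N ((U * P) * mat_diag ?m (\<lambda>i. complex_of_real (a i)) * mat_adjoint (U * P)
      - (V * P) * mat_diag ?m (\<lambda>i. complex_of_real (a' i)) * mat_adjoint (V * P))"
    unfolding a_def a'_def
    by (intro lidskii_simultaneously_sorted[OF N _ _ reverse_second_half_permutes]
        unitary_mat_mult U V P signed_spectrum_sorted[OF w] signed_spectrum_sorted[OF w'])
  also have "\<dots> \<le> N (?C W)"
    using UV unfolding HP HP' conj[OF Uc mat_diag_dim] conj[OF Vc mat_diag_dim] .
  also have "\<dots> \<le> sqrt (cond_number M) * (sqrt (cond_number M') * N (?C (M - M')))"
  proof -
    have k: "cond_number M \<ge> 0" "cond_number M' \<ge> 0" using cond_number_nonneg M M' n by auto
    have MM: "M - M' \<in> carrier_mat ?m ?m" using Mc by (auto intro!: minus_carrier_mat)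
    have MS: "?C (M - M') * ?C S' \<in> carrier_mat ?m ?m" using MM Sc by (simp add: carr)
    have CW: "?C W = mat_adjoint (?C S) * (?C (M - M') * ?C S')"
      unfolding W_def mat_adjoint_of_real R_def[symmetric] using MM Sc
      by (simp add: C_mult[symmetric] assoc carr)
    have SS: "?C (K * (R * J)) * ?C S = 1\<^sub>m ?m" "?C (K * (R' * J)) * ?C S' = 1\<^sub>m ?m"
      using cs inv(1) inv'(1) by (simp_all add: C_mult[symmetric] carr of_real_hom.mat_hom_one)
    have "N (?C W) \<le> sqrt (cond_number M) * N (?C (M - M') * ?C S')"
      unfolding CW using cs k
      by (intro uin_bounded_mult_le(1)[OF N _ _ SS(1) _ _ MS])
        (auto simp: carr intro!: symplectic_diagonaliser_bound_complex[OF M n w S SMS])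
    also have "N (?C (M - M') * ?C S') \<le> sqrt (cond_number M') * N (?C (M - M'))"
      using cs k MM
      by (intro uin_bounded_mult_le(2)[OF N _ _ SS(2)])
        (auto simp: carr intro!: symplectic_diagonaliser_bound_complex[OF M' n w' S' SMS'])
    finally show ?thesis using k by (simp add: mult_left_mono)
  qed
  finally show ?thesis unfolding T_def T'_def by (simp add: real_sqrt_mult mult.assoc)
qed

end
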